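(* Given $m$ strings $s_1,\dots,s_m$, each of length $n$, such that $\mathcal{L}(s_1,\dots,s_m)=\lambda n$ with $\lambda\in(0,1)$, there is an algorithm that computes $\mathcal{L}(s_1,\dots,s_m)$ exactly in time $\tilde{O}_m(\lambda n^m+nm)$.
   Context: $\mathcal{L}(s_1,\dots,s_m)$ denotes the length of a longest common subsequence of $s_1,\dots,s_m$. The notation $\tilde{O}_m(\cdot)$ hides factors of the form $c^m\log^m n$ with $c$ a constant, as well as polylogarithmic factors. *)

theory Defs
  imports Complex_Main "HOL-Library.Sublist"
begin

text \<open>
  For \<open>ss = []\<close> the set below is infinite and the maximum is unspecified.
\<close>

definition lcs_length :: "'a list list \<Rightarrow> nat" where
  "lcs_length ss = Max (length ` {t. \<forall>s\<in>set ss. subseq t s})"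

text \<open>
  The machine model is a deterministic word RAM, programmed by structured commands. It has
  registers, and a random access memory with one word per address. For word length \<open>w\<close>, a word is
  a natural number below \<open>2 ^ w\<close>; arithmetic is modulo \<open>2 ^ w\<close>, except that subtraction truncates
  at \<open>0\<close>. Addresses are words too, so the usable memory has \<open>2 ^ w\<close> cells.
  Every node of an expression and every executed command or test costs one time unit.
\<close>

datatype aexp =
    Const nat
  | Reg nat
  | Load aexp
  | Plus aexp aexp
  | Minus aexp aexp
  | Times aexp aexp
  | Div aexp aexp

datatype bexp =
    Less aexp aexp
  | Equal aexp aexp
  | BNot bexp
  | BAnd bexp bexp

datatype com =
    Skip
  | Assign nat aexp
  | Store aexp aexp
  | Seq com com
  | Cond bexp com com
  | While bexp com

record state =
  regs :: "nat \<Rightarrow> nat"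
  mem :: "nat \<Rightarrow> nat"

fun aval :: "nat \<Rightarrow> aexp \<Rightarrow> state \<Rightarrow> nat" where
  "aval w (Const k) \<sigma> = k mod 2 ^ w"
| "aval w (Reg r) \<sigma> = regs \<sigma> r"
| "aval w (Load a) \<sigma> = mem \<sigma> (aval w a \<sigma>)"
| "aval w (Plus a b) \<sigma> = (aval w a \<sigma> + aval w b \<sigma>) mod 2 ^ w"
| "aval w (Minus a b) \<sigma> = aval w a \<sigma> - aval w b \<sigma>"
| "aval w (Times a b) \<sigma> = (aval w a \<sigma> * aval w b \<sigma>) mod 2 ^ w"
| "aval w (Div a b) \<sigma> = aval w a \<sigma> div aval w b \<sigma>"

fun bval :: "nat \<Rightarrow> bexp \<Rightarrow> state \<Rightarrow> bool" where
  "bval w (Less a b) \<sigma> = (aval w a \<sigma> < aval w b \<sigma>)"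
| "bval w (Equal a b) \<sigma> = (aval w a \<sigma> = aval w b \<sigma>)"
| "bval w (BNot p) \<sigma> = (\<not> bval w p \<sigma>)"
| "bval w (BAnd p q) \<sigma> = (bval w p \<sigma> \<and> bval w q \<sigma>)"

fun acost :: "aexp \<Rightarrow> nat" where
  "acost (Const k) = 1"
| "acost (Reg r) = 1"
| "acost (Load a) = acost a + 1"
| "acost (Plus a b) = acost a + acost b + 1"
| "acost (Minus a b) = acost a + acost b + 1"
| "acost (Times a b) = acost a + acost b + 1"
| "acost (Div a b) = acost a + acost b + 1"

fun bcost :: "bexp \<Rightarrow> nat" where
  "bcost (Less a b) = acost a + acost b + 1"
| "bcost (Equal a b) = acost a + acost b + 1"
| "bcost (BNot p) = bcost p + 1"
| "bcost (BAnd p q) = bcost p + bcost q + 1"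

text \<open>
  \<open>exec w P \<sigma> t \<tau>\<close>: with word length \<open>w\<close>, program \<open>P\<close> started in \<open>\<sigma>\<close> halts in \<open>\<tau>\<close> after exactly
  \<open>t\<close> time units.
\<close>

inductive exec :: "nat \<Rightarrow> com \<Rightarrow> state \<Rightarrow> nat \<Rightarrow> state \<Rightarrow> bool" for w :: nat where
  Skip: "exec w Skip \<sigma> 1 \<sigma>"
| Assign: "exec w (Assign r a) \<sigma> (acost a + 1)
    (\<sigma>\<lparr>regs := (regs \<sigma>)(r := aval w a \<sigma>)\<rparr>)"
| Store: "exec w (Store a b) \<sigma> (acost a + acost b + 1)
    (\<sigma>\<lparr>mem := (mem \<sigma>)(aval w a \<sigma> := aval w b \<sigma>)\<rparr>)"
| Seq: "exec w P \<sigma> t \<sigma>' \<Longrightarrow> exec w Q \<sigma>' u \<tau> \<Longrightarrow> exec w (Seq P Q) \<sigma> (t + u) \<tau>"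
| CondTrue: "bval w p \<sigma> \<Longrightarrow> exec w P \<sigma> t \<tau> \<Longrightarrow> exec w (Cond p P Q) \<sigma> (bcost p + t + 1) \<tau>"
| CondFalse: "\<not> bval w p \<sigma> \<Longrightarrow> exec w Q \<sigma> t \<tau> \<Longrightarrow> exec w (Cond p P Q) \<sigma> (bcost p + t + 1) \<tau>"
| WhileFalse: "\<not> bval w p \<sigma> \<Longrightarrow> exec w (While p P) \<sigma> (bcost p + 1) \<sigma>"
| WhileTrue: "bval w p \<sigma> \<Longrightarrow> exec w P \<sigma> t \<sigma>' \<Longrightarrow> exec w (While p P) \<sigma>' u \<tau> \<Longrightarrow>
    exec w (While p P) \<sigma> (bcost p + t + u + 1) \<tau>"

inductive_cases exec_SkipE: "exec w Skip \<sigma> t \<tau>"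
inductive_cases exec_AssignE: "exec w (Assign r a) \<sigma> t \<tau>"
inductive_cases exec_StoreE: "exec w (Store a b) \<sigma> t \<tau>"
inductive_cases exec_SeqE: "exec w (Seq P Q) \<sigma> t \<tau>"
inductive_cases exec_CondE: "exec w (Cond p P Q) \<sigma> t \<tau>"
inductive_cases exec_WhileE: "exec w (While p P) \<sigma> t \<tau>"

lemma exec_deterministic:
  "exec w P \<sigma> t \<tau> \<Longrightarrow> exec w P \<sigma> t' \<tau>' \<Longrightarrow> t' = t \<and> \<tau>' = \<tau>"
proof (induction arbitrary: t' \<tau>' rule: exec.induct)
  case (Skip \<sigma>)
  then show ?case by (auto elim: exec_SkipE)
next
  case (Assign r a \<sigma>)
  then show ?case by (auto elim: exec_AssignE)
next
  case (Store a b \<sigma>)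
  then show ?case by (auto elim: exec_StoreE)
next
  case (Seq P \<sigma> t \<sigma>' Q u \<tau>)
  from Seq.prems obtain t1 \<rho> t2 where
    "t' = t1 + t2" "exec w P \<sigma> t1 \<rho>" "exec w Q \<rho> t2 \<tau>'"
    by (auto elim: exec_SeqE)
  with Seq.IH(1)[of t1 \<rho>] Seq.IH(2)[of t2 \<tau>'] show ?case by simp
next
  case (CondTrue p \<sigma> P t \<tau> Q)
  from CondTrue.prems CondTrue.hyps(1) obtain t1 where
    "t' = bcost p + t1 + 1" "exec w P \<sigma> t1 \<tau>'"
    by (auto elim: exec_CondE)
  with CondTrue.IH[of t1 \<tau>'] show ?case by simp
next
  case (CondFalse p \<sigma> Q t \<tau> P)
  from CondFalse.prems CondFalse.hyps(1) obtain t1 where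
    "t' = bcost p + t1 + 1" "exec w Q \<sigma> t1 \<tau>'"
    by (auto elim: exec_CondE)
  with CondFalse.IH[of t1 \<tau>'] show ?case by simp
next
  case (WhileFalse p \<sigma> P)
  from WhileFalse.prems show ?case
    by (rule exec_WhileE) (use WhileFalse.hyps in simp_all)
next
  case (WhileTrue p \<sigma> P t \<sigma>' u \<tau>)
  from WhileTrue.prems obtain t1 \<rho> t2 where
    "t' = bcost p + t1 + t2 + 1" "exec w P \<sigma> t1 \<rho>" "exec w (While p P) \<rho> t2 \<tau>'"
    by (rule exec_WhileE) (use WhileTrue.hyps(1) in simp_all)
  with WhileTrue.IH(1)[of t1 \<rho>] WhileTrue.IH(2)[of t2 \<tau>'] show ?case by simp
qed

text \<open>
  Input convention: the number \<open>m\<close> of strings is in register 0, their common length \<open>n\<close> in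
  register 1, and the strings are stored one after the other from address 0 on. Everything else
  is 0.
\<close>

definition input_state :: "nat \<Rightarrow> nat \<Rightarrow> nat list list \<Rightarrow> state" where
  "input_state m n ss =
    \<lparr>regs = (\<lambda>r. if r = 0 then m else if r = 1 then n else 0),
     mem = (\<lambda>a. if a < length (concat ss) then concat ss ! a else 0)\<rparr>"

definition result_of :: "state \<Rightarrow> nat" where
  "result_of \<sigma> = regs \<sigma> 0"

text \<open>
  The factors suppressed by the notation soft-O with subscript \<open>m\<close>: \<open>c ^ m * log ^ m n\<close> and a polylogarithmic factor.
\<close>

definition suppressed_factor :: "real \<Rightarrow> nat \<Rightarrow> nat \<Rightarrow> nat \<Rightarrow> real" where
  "suppressed_factor c k m n = c ^ m * (log 2 (real n)) ^ m * (log 2 (real n)) ^ k"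

end

theory Submission
  imports Defs
begin

text \<open>
  For prefixes of lengths \<open>p\<close> of the first \<open>m - 1\<close> strings let \<open>g k p\<close> be the largest \<open>v\<close> such that
  these prefixes and the prefix of length \<open>n + 1 - v\<close> of the last string have a common subsequence
  of length \<open>k\<close>, and 0 if there is none. A common subsequence of length \<open>k\<close> either avoids the last
  letter of one of the prefixes, or all prefixes end with the same letter, which may then be matched
  with its first occurrence in the last string behind the position given by \<open>g (k - 1) (p - 1)\<close>. So
  level \<open>k\<close> follows from level \<open>k - 1\<close>. If \<open>L\<close> is the length of a longest common subsequence, only
  the levels up to \<open>L + 1\<close> have to be filled, each with \<open>(n + 1) ^ (m - 1)\<close> entries.

  As the first coordinate of \<open>p\<close> grows, the position given by \<open>g (k - 1) (p - 1)\<close> only moves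
  backwards, so a single backward scan of the last string answers all occurrence queries on such a
  line, and an entry costs amortised time \<open>O(m)\<close>. The scan needs an array indexed by letters, so
  the letters are first renamed in linear time by direct addressing.
\<close>

section \<open>Common subsequences of prefixes\<close>

lemma lcs_length_map_inj:
  assumes "ss \<noteq> []" "inj_on f (\<Union>s\<in>set ss. set s)"
  shows "lcs_length (map (map f) ss) = lcs_length ss"
proof -
  let ?C = "{t. \<forall>s\<in>set ss. subseq t s}" and ?D = "{t. \<forall>s\<in>set (map (map f) ss). subseq t s}"
  have "length ` ?D = length ` ?C"
  proof (intro equalityI subsetI)
    fix l assume "l \<in> length ` ?D"
    then obtain t where t: "\<And>s. s \<in> set ss \<Longrightarrow> subseq t (map f s)" "l = length t" by auto
    have ex: "\<exists>u. subseq u s \<and> t = map f u" if s: "s \<in> set ss" for s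
    proof -
      obtain I where "t = nths (map f s) I" using t(1)[OF s] by (auto simp: subseq_conv_nths)
      then show ?thesis by (intro exI[of _ "nths s I"]) (simp add: subseq_conv_nths nths_map exI[of _ I])
    qed
    obtain s0 where s0: "s0 \<in> set ss" using assms(1) by (cases ss) auto
    obtain u where u: "subseq u s0" "t = map f u" using ex[OF s0] by blast
    have "subseq u s" if s: "s \<in> set ss" for s
    proof -
      obtain v where v: "subseq v s" "t = map f v" using ex[OF s] by blast
      have "set u \<subseteq> set s0" "set v \<subseteq> set s"
        using u(1) v(1) by (auto elim: list_emb_set)
      then have "set u \<union> set v \<subseteq> (\<Union>s\<in>set ss. set s)" using s s0 by blast
      then have "inj_on f (set u \<union> set v)" using assms(2) inj_on_subset by blast
      then have "u = v" using u(2) v(2) by (metis inj_on_map_eq_map)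
      then show ?thesis using v by simp
    qed
    then show "l \<in> length ` ?C" using t u by auto
  next
    fix l assume "l \<in> length ` ?C"
    then obtain t where t: "\<And>s. s \<in> set ss \<Longrightarrow> subseq t s" "l = length t" by auto
    then have "map f t \<in> ?D" by (auto intro: subseq_map)
    then show "l \<in> length ` ?D" by (rule image_eqI[rotated]) (simp add: t(2))
  qed
  then show ?thesis by (simp add: lcs_length_def)
qed

lemma le_lcs_length_iff:
  assumes "ss \<noteq> []"
  shows "k \<le> lcs_length ss \<longleftrightarrow> (\<exists>t. length t = k \<and> (\<forall>s\<in>set ss. subseq t s))"
proof -
  let ?C = "{t. \<forall>s\<in>set ss. subseq t s}"
  have fin: "finite (length ` ?C)"
  proof (rule finite_subset)
    show "length ` ?C \<subseteq> {..length (hd ss)}"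
      using assms by (auto dest!: bspec[of _ _ "hd ss"] intro: list_emb_length)
  qed simp
  have ne: "length ` ?C \<noteq> {}" by (auto intro: exI[of _ "[]"])
  show ?thesis
  proof
    assume k: "k \<le> lcs_length ss"
    have "lcs_length ss \<in> length ` ?C" unfolding lcs_length_def by (rule Max_in[OF fin ne])
    then obtain t where t: "t \<in> ?C" "length t = lcs_length ss" by auto
    have "subseq (take k t) t" by (simp add: prefix_imp_subseq take_is_prefix)
    then have "\<forall>s\<in>set ss. subseq (take k t) s" "length (take k t) = k"
      using t k by (auto intro: subseq_order.order_trans)
    then show "\<exists>t. length t = k \<and> (\<forall>s\<in>set ss. subseq t s)" by blast
  next
    assume "\<exists>t. length t = k \<and> (\<forall>s\<in>set ss. subseq t s)"
    then show "k \<le> lcs_length ss" unfolding lcs_length_def by (intro Max_ge[OF fin]) auto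
  qed
qed

lemma subseq_snoc_take_Suc:
  assumes "j < length s"
  shows "subseq (t @ [a]) (take (Suc j) s) \<longleftrightarrow>
    subseq (t @ [a]) (take j s) \<or> s ! j = a \<and> subseq t (take j s)"
proof -
  have "subseq (t @ [a]) (u @ [b]) \<longleftrightarrow> subseq (t @ [a]) u \<or> b = a \<and> subseq t u" for u b
  proof
    assume "subseq (t @ [a]) (u @ [b])"
    then obtain x y where xy: "t @ [a] = x @ y" "subseq x u" "subseq y [b]"
      by (auto simp: subseq_append_iff)
    then have "y = [] \<or> y = [b]" by (cases y) (auto split: if_splits)
    then show "subseq (t @ [a]) u \<or> b = a \<and> subseq t u" using xy by auto
  next
    assume "subseq (t @ [a]) u \<or> b = a \<and> subseq t u"
    then show "subseq (t @ [a]) (u @ [b])" by (auto intro: list_emb_append_mono)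
  qed
  then show ?thesis using assms by (simp add: take_Suc_conv_app_nth)
qed

lemma subseq_snoc_takeD:
  assumes "subseq (t @ [a]) (take x s)"
  shows "\<exists>y<x. y < length s \<and> s ! y = a \<and> subseq t (take y s)"
  using assms
proof (induction x)
  case (Suc x)
  show ?case
  proof (cases "x < length s")
    case True
    then show ?thesis using Suc by (auto simp: subseq_snoc_take_Suc less_Suc_eq)
  next
    case False
    then show ?thesis using Suc by (auto simp: less_Suc_eq)
  qed
qed simp

lemma subseq_take_mono: "subseq t (take x s) \<Longrightarrow> x \<le> y \<Longrightarrow> subseq t (take y s)"
  using subseq_order.order_trans[of t "take x s" "take y s"] take_is_prefix[of x "take y s"]
  by (simp add: prefix_imp_subseq min_absorb1)

definition prefixes_common :: "(nat \<Rightarrow> 'a list) \<Rightarrow> 'a list \<Rightarrow> nat \<Rightarrow> nat \<Rightarrow> (nat \<Rightarrow> nat) \<Rightarrow> nat \<Rightarrow> bool" where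
  "prefixes_common S Z M k p x \<longleftrightarrow>
    (\<exists>t. length t = k \<and> (\<forall>i<M. subseq t (take (p i) (S i))) \<and> subseq t (take x Z))"

lemma prefixes_common_mono:
  "prefixes_common S Z M k p x \<Longrightarrow> (\<And>i. i < M \<Longrightarrow> p i \<le> p' i) \<Longrightarrow> x \<le> x' \<Longrightarrow>
    prefixes_common S Z M k p' x'"
  unfolding prefixes_common_def by (elim exE conjE, rule exI) (auto intro: subseq_take_mono)

lemma prefixes_common_Suc_iff:
  assumes len: "\<And>i. i < M \<Longrightarrow> p i \<le> length (S i)"
  shows "prefixes_common S Z M (Suc k) p x \<longleftrightarrow>
    (\<exists>i<M. 0 < p i \<and> prefixes_common S Z M (Suc k) (p(i := p i - 1)) x) \<or>
    (\<exists>y<x. y < length Z \<and> (\<forall>i<M. 0 < p i \<and> S i ! (p i - 1) = Z ! y) \<and>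
      prefixes_common S Z M k (\<lambda>i. p i - 1) y)" (is "?L \<longleftrightarrow> ?A \<or> ?B")
proof
  assume ?L
  then obtain u where u: "length u = Suc k" "\<And>i. i < M \<Longrightarrow> subseq u (take (p i) (S i))"
    "subseq u (take x Z)" unfolding prefixes_common_def by blast
  then obtain t a where ta: "u = t @ [a]" by (metis append_butlast_last_id length_0_conv nat.distinct(1))
  have pos: "0 < p i" if "i < M" for i using u(2)[OF that] by (cases "p i") (auto simp: ta)
  have step: "subseq u (take (p i - 1) (S i)) \<or> S i ! (p i - 1) = a \<and> subseq t (take (p i - 1) (S i))"
    if "i < M" for i
    using u(2)[OF that] pos[OF that] len[OF that] subseq_snoc_take_Suc[of "p i - 1" "S i" t a]
    by (simp add: ta)
  show "?A \<or> ?B"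
  proof (cases "\<exists>i<M. subseq u (take (p i - 1) (S i))")
    case True
    then obtain i where "i < M" "subseq u (take (p i - 1) (S i))" by blast
    then have ?A using u pos unfolding prefixes_common_def by (intro exI[of _ i]) auto
    then show ?thesis ..
  next
    case False
    obtain y where "y < x" "y < length Z" "Z ! y = a" "subseq t (take y Z)"
      using subseq_snoc_takeD[of t a x Z] u(3) ta by auto
    moreover have "S i ! (p i - 1) = a" "subseq t (take (p i - 1) (S i))" if "i < M" for i
      using False step[OF that] that by auto
    moreover have "length t = k" using u(1) ta by simp
    ultimately have ?B unfolding prefixes_common_def using pos
      by (intro exI[of _ y] conjI exI[of _ t] allI impI) simp_all
    then show ?thesis ..
  qed
next
  assume "?A \<or> ?B"
  then show ?L
  proof
    assume ?A
    then obtain i where "i < M" "prefixes_common S Z M (Suc k) (p(i := p i - 1)) x" by blast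
    then show ?L by (auto intro: prefixes_common_mono[OF \<open>prefixes_common S Z M (Suc k) (p(i := p i - 1)) x\<close>])
  next
    assume ?B
    then obtain y t where y: "y < x" "y < length Z" "\<And>i. i < M \<Longrightarrow> 0 < p i \<and> S i ! (p i - 1) = Z ! y"
      "length t = k" "\<And>i. i < M \<Longrightarrow> subseq t (take (p i - 1) (S i))" "subseq t (take y Z)"
      unfolding prefixes_common_def by blast
    have "subseq (t @ [Z ! y]) (take (p i) (S i))" if "i < M" for i
    proof -
      have "p i - 1 < length (S i)" "Suc (p i - 1) = p i" using y(3)[OF that] len[OF that] by auto
      then show ?thesis
        using y(3,5)[OF that] subseq_snoc_take_Suc[of "p i - 1" "S i" t "Z ! y"] by simp
    qed
    moreover have "subseq (t @ [Z ! y]) (take (Suc y) Z)"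
      using y(2,6) subseq_snoc_take_Suc[of y Z t "Z ! y"] by simp
    then have "subseq (t @ [Z ! y]) (take x Z)" using y(1) by (simp add: subseq_take_mono)
    ultimately show ?L unfolding prefixes_common_def using y(4)
      by (intro exI[of _ "t @ [Z ! y]"] conjI allI impI) simp_all
  qed
qed

definition digit :: "nat \<Rightarrow> nat \<Rightarrow> nat \<Rightarrow> nat" where
  "digit B i x = x div B ^ i mod B"

definition undigit :: "nat \<Rightarrow> nat \<Rightarrow> (nat \<Rightarrow> nat) \<Rightarrow> nat" where
  "undigit B M p = (\<Sum>i<M. p i * B ^ i)"

lemma undigit_less: "(\<And>i. i < M \<Longrightarrow> p i < B) \<Longrightarrow> undigit B M p < B ^ M"
proof (induction M)
  case (Suc M)
  then have "undigit B M p < B ^ M" "p M + 1 \<le> B" by (auto simp: Suc_le_eq)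
  moreover have "(p M + 1) * B ^ M \<le> B * B ^ M" using calculation(2) by (rule mult_right_mono) simp
  ultimately show ?case by (simp add: undigit_def)
qed (simp add: undigit_def)

lemma digit_undigit:
  assumes "i < M" "\<And>i. i < M \<Longrightarrow> p i < B"
  shows "digit B i (undigit B M p) = p i"
  using assms
proof (induction M)
  case (Suc M)
  have l: "undigit B M p < B ^ M" using Suc.prems by (intro undigit_less) simp
  have B: "B > 0" using Suc.prems by fastforce
  have e: "undigit B (Suc M) p = undigit B M p + p M * B ^ M" by (simp add: undigit_def)
  show ?case
  proof (cases "i = M")
    case True
    then show ?thesis using l B Suc.prems(2)[of M] by (simp add: e digit_def)
  next
    case False
    then have "i < M" using Suc.prems by simp
    then obtain d where d: "M = i + Suc d" using less_imp_Suc_add by auto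
    have "p M * B ^ M = (p M * B ^ d * B) * B ^ i" by (simp add: d power_add)
    then have "undigit B (Suc M) p = undigit B M p + (p M * B ^ d * B) * B ^ i" using e by simp
    then have "undigit B (Suc M) p div B ^ i = undigit B M p div B ^ i + p M * B ^ d * B"
      using B by (simp only: div_mult_self3 power_eq_0_iff) simp
    then show ?thesis using Suc \<open>i < M\<close> by (simp add: digit_def)
  qed
qed simp

lemma undigit_digit: "undigit B M (\<lambda>i. digit B i x) = x mod B ^ M"
proof (induction M)
  case (Suc M)
  then show ?case by (simp add: undigit_def digit_def mod_mult2_eq mult.commute[of B] mult.commute[of _ "B ^ M"])
qed (simp add: undigit_def)

lemma digit_diff_power:
  assumes x: "x < B ^ M" and i: "i < M" "0 < digit B i x" and j: "j < M"
  shows "digit B j (x - B ^ i) = ((\<lambda>i. digit B i x)(i := digit B i x - 1)) j"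
    and "B ^ i \<le> x"
proof -
  let ?d = "\<lambda>i. digit B i x"
  let ?p = "?d(i := ?d i - 1)"
  have B: "B > 0" using x i by (cases B) (auto simp: power_0_left split: if_splits)
  have x': "x = undigit B M ?d" using x by (simp add: undigit_digit)
  have "undigit B M ?d = ?d i * B ^ i + (\<Sum>j\<in>{..<M} - {i}. ?d j * B ^ j)"
    unfolding undigit_def using i by (subst sum.remove[of _ i]) auto
  moreover have "undigit B M ?p = (?d i - 1) * B ^ i + (\<Sum>j\<in>{..<M} - {i}. ?d j * B ^ j)"
    unfolding undigit_def using i by (subst sum.remove[of _ i]) auto
  moreover have "?d i * B ^ i = (?d i - 1) * B ^ i + B ^ i" using i by (simp add: mult_eq_if)
  ultimately have e: "x = undigit B M ?p + B ^ i" using x' by linarith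
  have "?d j < B" for j using B by (simp add: digit_def)
  then have lt: "?p j < B" for j using less_imp_diff_less by simp
  show "B ^ i \<le> x" using e by simp
  have "digit B j (undigit B M ?p) = ?p j" using j lt by (rule digit_undigit)
  then show "digit B j (x - B ^ i) = ?p j" using e by (metis diff_add_inverse2)
qed

lemma digit_diff_repunit:
  assumes x: "x < B ^ M" and pos: "\<And>i. i < M \<Longrightarrow> 0 < digit B i x" and j: "j < M"
  shows "digit B j (x - (\<Sum>i<M. B ^ i)) = digit B j x - 1"
    and "(\<Sum>i<M. B ^ i) \<le> x"
proof -
  let ?d = "\<lambda>i. digit B i x"
  have B: "B > 0" using x j by (cases B) (auto simp: power_0_left split: if_splits)
  have "undigit B M ?d = undigit B M (\<lambda>i. ?d i - 1) + (\<Sum>i<M. B ^ i)"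
    unfolding undigit_def sum.distrib[symmetric]
    by (rule sum.cong) (use pos in \<open>force simp: mult_eq_if\<close>)+
  then have e: "x = undigit B M (\<lambda>i. ?d i - 1) + (\<Sum>i<M. B ^ i)" using x by (simp add: undigit_digit)
  have "?d j < B" for j using B by (simp add: digit_def)
  then have lt: "?d j - 1 < B" for j using less_imp_diff_less by simp
  show "(\<Sum>i<M. B ^ i) \<le> x" using e by simp
  have "digit B j (undigit B M (\<lambda>i. ?d i - 1)) = ?d j - 1" using j lt by (rule digit_undigit)
  then show "digit B j (x - (\<Sum>i<M. B ^ i)) = ?d j - 1" using e by (metis diff_add_inverse2)
qed

lemma digit_power_minus_1:
  assumes "B > 0" "j < M"
  shows "digit B j (B ^ M - 1) = B - 1"
proof -
  have "undigit B M (\<lambda>i. B - 1) = B ^ M - 1"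
  proof (induction M)
    case (Suc M)
    have "B ^ M \<le> B * B ^ M" "1 \<le> B ^ M" using assms by simp_all
    then show ?case using Suc by (simp add: undigit_def diff_mult_distrib)
  qed (simp add: undigit_def)
  then show ?thesis using digit_undigit[of j M "\<lambda>i. B - 1" B] assms by simp
qed

lemma digit_Suc_line:
  assumes "Suc x mod B \<noteq> 0"
  shows "digit B i x \<le> digit B i (Suc x)"
proof (cases i)
  case 0
  then show ?thesis using assms by (simp add: digit_def mod_Suc split: if_splits)
next
  case (Suc j)
  have "Suc x div B = x div B" using assms by (simp add: div_Suc)
  then show ?thesis using Suc by (simp add: digit_def div_mult2_eq)
qed

section \<open>The recurrence\<close>

locale strings =
  fixes S :: "nat \<Rightarrow> nat list" and Z :: "nat list" and M n B :: nat
  assumes B_eq: "B = Suc n" and len_S: "i < M \<Longrightarrow> length (S i) = n" and len_Z: "length Z = n"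
    and M_ge: "M \<ge> 1"
begin

abbreviation "level_size \<equiv> B ^ M"
abbreviation "repunit \<equiv> \<Sum>i<M. B ^ i"
abbreviation "dig x i \<equiv> digit B i x"

text \<open>
  Positions of the last string are counted from its end, so that 0 can stand for a missing one and
  minima become maxima.
\<close>

definition gval :: "nat \<Rightarrow> (nat \<Rightarrow> nat) \<Rightarrow> nat" where
  "gval k p = Max (insert 0 {v. 1 \<le> v \<and> v \<le> Suc n \<and> prefixes_common S Z M k p (Suc n - v)})"

lemma gval_eqI:
  assumes "g \<le> Suc n"
    "\<And>v. 1 \<le> v \<Longrightarrow> v \<le> Suc n \<Longrightarrow> v \<le> g \<longleftrightarrow> prefixes_common S Z M k p (Suc n - v)"
  shows "gval k p = g"
  unfolding gval_def
proof (rule Max_eqI)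
  show "finite (insert 0 {v. 1 \<le> v \<and> v \<le> Suc n \<and> prefixes_common S Z M k p (Suc n - v)})"
    by (rule finite_subset[of _ "{..n+1}"]) auto
  show "v \<le> g" if "v \<in> insert 0 {v. 1 \<le> v \<and> v \<le> Suc n \<and> prefixes_common S Z M k p (Suc n - v)}" for v
    using that assms(2)[of v] by auto
  show "g \<in> insert 0 {v. 1 \<le> v \<and> v \<le> Suc n \<and> prefixes_common S Z M k p (Suc n - v)}"
    using assms(1) assms(2)[of g] by auto
qed

lemma gval_le: "gval k p \<le> Suc n"
  unfolding gval_def by (subst Max_le_iff) (auto intro: finite_subset[of _ "{..n+1}"])

lemma le_gval_iff:
  assumes "1 \<le> v" "v \<le> Suc n"
  shows "v \<le> gval k p \<longleftrightarrow> prefixes_common S Z M k p (Suc n - v)"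
proof
  have fin: "finite (insert 0 {v. 1 \<le> v \<and> v \<le> Suc n \<and> prefixes_common S Z M k p (Suc n - v)})"
    by (rule finite_subset[of _ "{..n+1}"]) auto
  show "v \<le> gval k p" if "prefixes_common S Z M k p (Suc n - v)"
    unfolding gval_def using assms that by (intro Max_ge[OF fin]) auto
  assume v: "v \<le> gval k p"
  have "gval k p \<in> insert 0 {v. 1 \<le> v \<and> v \<le> Suc n \<and> prefixes_common S Z M k p (Suc n - v)}"
    unfolding gval_def by (rule Max_in[OF fin]) simp
  then have "prefixes_common S Z M k p (Suc n - gval k p)" using v assms by auto
  then show "prefixes_common S Z M k p (Suc n - v)" by (rule prefixes_common_mono) (use v in auto)
qed

lemma gval_mono: "(\<And>i. i < M \<Longrightarrow> p i \<le> p' i) \<Longrightarrow> gval k p \<le> gval k p'"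
proof (cases "gval k p = 0")
  case False
  assume le: "\<And>i. i < M \<Longrightarrow> p i \<le> p' i"
  have "prefixes_common S Z M k p (Suc n - gval k p)"
    using le_gval_iff[of "gval k p" k p] gval_le[of k p] False by simp
  then have "prefixes_common S Z M k p' (Suc n - gval k p)" by (rule prefixes_common_mono) (use le in auto)
  then show ?thesis using le_gval_iff[of "gval k p" k p'] gval_le[of k p] False by simp
qed simp

lemma gval_cong: "(\<And>i. i < M \<Longrightarrow> p i = p' i) \<Longrightarrow> gval k p = gval k p'"
  by (intro antisym gval_mono) auto

lemma gval_0: "gval 0 p = Suc n"
  by (rule gval_eqI) (auto simp: prefixes_common_def)

primrec scan :: "nat \<Rightarrow> nat \<Rightarrow> nat" where
  "scan 0 a = 0"
| "scan (Suc q) a = (if Z ! (n - q) = a then q else scan q a)"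

lemma le_scan_iff: "1 \<le> v \<Longrightarrow> v \<le> scan q a \<longleftrightarrow> (\<exists>u. v \<le> u \<and> u < q \<and> Z ! (n - u) = a)"
proof (induction q)
  case (Suc q)
  show ?case
  proof (cases "Z ! (n - q) = a")
    case True
    then show ?thesis by (auto intro!: exI[of _ q])
  next
    case False
    then show ?thesis using Suc by (auto simp: less_Suc_eq)
  qed
qed auto

lemma scan_le: "scan q a \<le> q" by (induction q) auto

primrec best :: "nat \<Rightarrow> nat \<Rightarrow> nat \<Rightarrow> nat" where
  "best k x 0 = 0"
| "best k x (Suc i) = (if dig x i = 0 then best k x i else max (best k x i) (gval k (dig (x - B ^ i))))"

lemma le_best_iff: "1 \<le> v \<Longrightarrow> v \<le> best k x i \<longleftrightarrow> (\<exists>j<i. 0 < dig x j \<and> v \<le> gval k (dig (x - B ^ j)))"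
  by (induction i) (auto simp: less_Suc_eq le_max_iff_disj)

lemma best_le: "best k x i \<le> Suc n"
  by (induction i) (auto simp: gval_le simp del: One_nat_def)

definition matches :: "nat \<Rightarrow> nat \<Rightarrow> nat \<Rightarrow> bool" where
  "matches x a i \<longleftrightarrow> (\<forall>j<i. 0 < dig x j \<and> S j ! (dig x j - 1) = a)"

lemma dig_le: "dig x i \<le> n" by (simp add: digit_def B_eq less_Suc_eq_le[symmetric] del: less_Suc_eq_le)

lemma gval_diff_power:
  "x < level_size \<Longrightarrow> i < M \<Longrightarrow> 0 < dig x i \<Longrightarrow> gval k (dig (x - B ^ i)) = gval k ((dig x)(i := dig x i - 1))"
  by (rule gval_cong) (rule digit_diff_power(1))

lemma gval_diff_repunit:
  "x < level_size \<Longrightarrow> (\<And>i. i < M \<Longrightarrow> 0 < dig x i) \<Longrightarrow> gval k (dig (x - repunit)) = gval k (\<lambda>i. dig x i - 1)"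
  by (rule gval_cong) (rule digit_diff_repunit(1))

lemma gval_Suc:
  assumes x: "x < level_size" and a: "0 < dig x 0 \<Longrightarrow> a = S 0 ! (dig x 0 - 1)"
  shows "gval (Suc k) (dig x) =
    max (best (Suc k) x M) (if matches x a M then scan (gval k (dig (x - repunit))) a else 0)" (is "_ = ?r")
proof (rule gval_eqI)
  have "scan (gval k (dig (x - repunit))) a \<le> Suc n" by (rule order_trans[OF scan_le gval_le])
  then show "?r \<le> Suc n" using best_le by simp
  fix v assume v: "1 \<le> v" "v \<le> Suc n"
  have best: "v \<le> best (Suc k) x M \<longleftrightarrow>
    (\<exists>i<M. 0 < dig x i \<and> prefixes_common S Z M (Suc k) ((dig x)(i := dig x i - 1)) (Suc n - v))"
  proof -
    have "v \<le> gval (Suc k) (dig (x - B ^ i)) \<longleftrightarrow>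
      prefixes_common S Z M (Suc k) ((dig x)(i := dig x i - 1)) (Suc n - v)" if "i < M" "0 < dig x i" for i
      unfolding gval_diff_power[OF x that] by (rule le_gval_iff[OF v])
    then show ?thesis unfolding le_best_iff[OF v(1)] by blast
  qed
  have scan: "v \<le> (if matches x a M then scan (gval k (dig (x - repunit))) a else 0) \<longleftrightarrow>
    (\<exists>y<Suc n - v. y < length Z \<and> (\<forall>i<M. 0 < dig x i \<and> S i ! (dig x i - 1) = Z ! y) \<and>
      prefixes_common S Z M k (\<lambda>i. dig x i - 1) y)" (is "?l \<longleftrightarrow> ?e")
  proof
    assume ?l
    then have m: "matches x a M" using v by (auto split: if_splits)
    then obtain u where u: "v \<le> u" "u < gval k (dig (x - repunit))" "Z ! (n - u) = a"
      using \<open>?l\<close> v le_scan_iff by auto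
    have g: "gval k (dig (x - repunit)) = gval k (\<lambda>i. dig x i - 1)"
      using m x by (intro gval_diff_repunit) (auto simp: matches_def)
    have un: "u + 1 \<le> Suc n" using u(2) gval_le[of k "dig (x - repunit)"] by linarith
    then have "prefixes_common S Z M k (\<lambda>i. dig x i - 1) (Suc n - (u + 1))"
      using u(2) g le_gval_iff[of "u + 1" k "\<lambda>i. dig x i - 1"] by simp
    then show ?e using u un m v len_Z by (intro exI[of _ "n - u"]) (auto simp: matches_def)
  next
    assume ?e
    then obtain y where y: "y < Suc n - v" "y < n" "\<And>i. i < M \<Longrightarrow> 0 < dig x i \<and> S i ! (dig x i - 1) = Z ! y"
      "prefixes_common S Z M k (\<lambda>i. dig x i - 1) y" using len_Z by blast
    have az: "a = Z ! y" using y(3)[of 0] a M_ge by simp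
    then have m: "matches x a M" using y(3) by (auto simp: matches_def)
    have g: "gval k (dig (x - repunit)) = gval k (\<lambda>i. dig x i - 1)"
      using y(3) x by (intro gval_diff_repunit) auto
    have "n - y + 1 \<le> gval k (dig (x - repunit))"
      unfolding g using y by (subst le_gval_iff) (auto simp: Suc_diff_le)
    then have "v \<le> scan (gval k (dig (x - repunit))) a"
      using y az v by (subst le_scan_iff) (auto intro!: exI[of _ "n - y"])
    then show ?l using m by simp
  qed
  have "prefixes_common S Z M (Suc k) (dig x) (Suc n - v) \<longleftrightarrow>
    v \<le> best (Suc k) x M \<or> v \<le> (if matches x a M then scan (gval k (dig (x - repunit))) a else 0)"
    unfolding best scan by (rule prefixes_common_Suc_iff) (simp add: len_S dig_le)
  then show "v \<le> ?r \<longleftrightarrow> prefixes_common S Z M (Suc k) (dig x) (Suc n - v)"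
    unfolding le_max_iff_disj by (rule sym)
qed

lemma gval_full_pos:
  "0 < gval k (dig (level_size - 1)) \<longleftrightarrow> k \<le> lcs_length (map S [0..<M] @ [Z])"
proof -
  have "0 < gval k (dig (level_size - 1)) \<longleftrightarrow> prefixes_common S Z M k (dig (level_size - 1)) n"
    using le_gval_iff[of 1 k "dig (level_size - 1)"] by auto
  also have "\<dots> \<longleftrightarrow> (\<exists>t. length t = k \<and> (\<forall>s\<in>set (map S [0..<M] @ [Z]). subseq t s))"
  proof -
    have "take (dig (level_size - 1) i) (S i) = S i" if "i < M" for i
      using digit_power_minus_1[of B i M] that by (simp add: len_S B_eq)
    moreover have "(\<forall>i<M. P (S i)) \<longleftrightarrow> (\<forall>s\<in>set (map S [0..<M]). P s)" for P by auto
    ultimately show ?thesis unfolding prefixes_common_def by (simp add: len_Z) blast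
  qed
  also have "\<dots> \<longleftrightarrow> k \<le> lcs_length (map S [0..<M] @ [Z])" by (simp add: le_lcs_length_iff)
  finally show ?thesis .
qed

lemma gval_line_mono:
  "Suc x mod B \<noteq> 0 \<Longrightarrow> gval k (\<lambda>i. dig x i - 1) \<le> gval k (\<lambda>i. dig (Suc x) i - 1)"
  by (intro gval_mono diff_le_mono digit_Suc_line)

end

section \<open>Time-bounded weakest preconditions\<close>

fun av :: "nat \<Rightarrow> (nat \<Rightarrow> nat) \<Rightarrow> (nat \<Rightarrow> nat) \<Rightarrow> aexp \<Rightarrow> nat" where
  "av U R H (Const k) = k mod U"
| "av U R H (Reg r) = R r"
| "av U R H (Load a) = H (av U R H a)"
| "av U R H (Plus a b) = (av U R H a + av U R H b) mod U"
| "av U R H (Minus a b) = av U R H a - av U R H b"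
| "av U R H (Times a b) = (av U R H a * av U R H b) mod U"
| "av U R H (Div a b) = av U R H a div av U R H b"

fun bv :: "nat \<Rightarrow> (nat \<Rightarrow> nat) \<Rightarrow> (nat \<Rightarrow> nat) \<Rightarrow> bexp \<Rightarrow> bool" where
  "bv U R H (Less a b) \<longleftrightarrow> av U R H a < av U R H b"
| "bv U R H (Equal a b) \<longleftrightarrow> av U R H a = av U R H b"
| "bv U R H (BNot p) \<longleftrightarrow> \<not> bv U R H p"
| "bv U R H (BAnd p q) \<longleftrightarrow> bv U R H p \<and> bv U R H q"

locale word_ram =
  fixes w U :: nat
  assumes U_eq: "U = 2 ^ w"
begin

lemma aval_eq_av: "aval w e \<lparr>regs = R, mem = H\<rparr> = av U R H e"
  by (induction e) (simp_all add: U_eq)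

lemma bval_eq_bv: "bval w p \<lparr>regs = R, mem = H\<rparr> = bv U R H p"
  by (induction p) (simp_all add: aval_eq_av)

text \<open>Execution with \<open>T\<close> units of fuel; the postcondition receives the unspent fuel, so that
  loop invariants bound the running time and make loops terminate at once.\<close>

definition wp :: "com \<Rightarrow> ((nat \<Rightarrow> nat) \<Rightarrow> (nat \<Rightarrow> nat) \<Rightarrow> nat \<Rightarrow> bool) \<Rightarrow>
    (nat \<Rightarrow> nat) \<Rightarrow> (nat \<Rightarrow> nat) \<Rightarrow> nat \<Rightarrow> bool" where
  "wp P Q R H T \<longleftrightarrow> (\<exists>t R' H'. exec w P \<lparr>regs = R, mem = H\<rparr> t \<lparr>regs = R', mem = H'\<rparr> \<and>
    t \<le> T \<and> Q R' H' (T - t))"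

lemma wp_Skip: "1 \<le> T \<Longrightarrow> Q R H (T - 1) \<Longrightarrow> wp Skip Q R H T"
  unfolding wp_def using exec.Skip by blast

lemma wp_Assign:
  "acost a + 1 \<le> T \<Longrightarrow> Q (R(r := av U R H a)) H (T - (acost a + 1)) \<Longrightarrow> wp (Assign r a) Q R H T"
  unfolding wp_def using exec.Assign[of w r a "\<lparr>regs = R, mem = H\<rparr>"]
  by (auto simp: aval_eq_av)

lemma wp_Store:
  "acost a + acost b + 1 \<le> T \<Longrightarrow> Q R (H(av U R H a := av U R H b)) (T - (acost a + acost b + 1)) \<Longrightarrow>
    wp (Store a b) Q R H T"
  unfolding wp_def using exec.Store[of w a b "\<lparr>regs = R, mem = H\<rparr>"]
  by (auto simp: aval_eq_av)

lemma wp_Seq: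
  assumes "wp P (wp P' Q) R H T"
  shows "wp (Seq P P') Q R H T"
proof -
  obtain t R' H' t' R'' H'' where
    "exec w P \<lparr>regs = R, mem = H\<rparr> t \<lparr>regs = R', mem = H'\<rparr>" "t \<le> T"
    "exec w P' \<lparr>regs = R', mem = H'\<rparr> t' \<lparr>regs = R'', mem = H''\<rparr>" "t' \<le> T - t" "Q R'' H'' (T - t - t')"
    using assms unfolding wp_def by blast
  then show ?thesis unfolding wp_def
    by (intro exI[of _ "t + t'"] exI[of _ R''] exI[of _ H'']) (auto intro: exec.Seq)
qed

lemma wp_Seq_Assign:
  "acost a + 1 \<le> T \<Longrightarrow> wp P Q (R(r := av U R H a)) H (T - (acost a + 1)) \<Longrightarrow>
    wp (Seq (Assign r a) P) Q R H T"
  by (intro wp_Seq wp_Assign)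

lemma wp_Cond:
  assumes "bcost p + 1 \<le> T"
    "bv U R H p \<Longrightarrow> wp P Q R H (T - (bcost p + 1))"
    "\<not> bv U R H p \<Longrightarrow> wp P' Q R H (T - (bcost p + 1))"
  shows "wp (Cond p P P') Q R H T"
proof -
  obtain t R' H' where "exec w (if bv U R H p then P else P') \<lparr>regs = R, mem = H\<rparr> t \<lparr>regs = R', mem = H'\<rparr>"
    "t \<le> T - (bcost p + 1)" "Q R' H' (T - (bcost p + 1) - t)"
    using assms(2,3) unfolding wp_def by (cases "bv U R H p") auto
  then show ?thesis using assms(1) unfolding wp_def
    by (intro exI[of _ "bcost p + t + 1"] exI[of _ R'] exI[of _ H'])
      (auto simp: bval_eq_bv add.commute intro: exec.CondTrue[of _ _ _ _ t, simplified] exec.CondFalse[of _ _ _ _ t, simplified] split: if_splits)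
qed

lemma wp_Cond_True:
  "bv U R H p \<Longrightarrow> bcost p + 1 \<le> T \<Longrightarrow> wp P Q R H (T - (bcost p + 1)) \<Longrightarrow> wp (Cond p P P') Q R H T"
  by (rule wp_Cond) auto

lemma wp_Cond_False:
  "\<not> bv U R H p \<Longrightarrow> bcost p + 1 \<le> T \<Longrightarrow> wp P' Q R H (T - (bcost p + 1)) \<Longrightarrow> wp (Cond p P P') Q R H T"
  by (rule wp_Cond) auto

lemma wp_Raise:
  assumes "2 * acost a + 4 \<le> T"
    "\<And>t. T - (2 * acost a + 4) \<le> t \<Longrightarrow> Q (R(r := max (R r) (av U R H a))) H t"
  shows "wp (Cond (Less (Reg r) a) (Assign r a) Skip) Q R H T"
proof (cases "R r < av U R H a")
  case True
  then show ?thesis using assms(1) assms(2)[of "T - (acost a + acost a + 4)"]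
    by (intro wp_Cond_True wp_Assign) (auto simp: max_def numeral_eq_Suc)
next
  case False
  then have "R(r := max (R r) (av U R H a)) = R" by (auto simp: max_def)
  then show ?thesis using False assms(1) assms(2)[of "T - (acost a + 4)"]
    by (intro wp_Cond_False wp_Skip) (auto simp: numeral_eq_Suc diff_le_mono2)
qed

lemma wp_While:
  assumes "I R H T"
    and step: "\<And>R H T. I R H T \<Longrightarrow> bcost p + 1 \<le> T"
      "\<And>R H T. I R H T \<Longrightarrow> bv U R H p \<Longrightarrow> wp P I R H (T - (bcost p + 1))"
      "\<And>R H T. I R H T \<Longrightarrow> \<not> bv U R H p \<Longrightarrow> Q R H (T - (bcost p + 1))"
  shows "wp (While p P) Q R H T"
  using assms(1)
proof (induction T arbitrary: R H rule: less_induct)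
  case (less T)
  show ?case
  proof (cases "bv U R H p")
    case True
    then obtain t R' H' where t: "exec w P \<lparr>regs = R, mem = H\<rparr> t \<lparr>regs = R', mem = H'\<rparr>"
      "t \<le> T - (bcost p + 1)" "I R' H' (T - (bcost p + 1) - t)"
      using step(2)[OF less.prems] unfolding wp_def by blast
    have "T - (bcost p + 1) - t < T" using step(1)[OF less.prems] by simp
    then have "wp (While p P) Q R' H' (T - (bcost p + 1) - t)" using less.IH t(3) by blast
    then obtain u R'' H'' where u: "exec w (While p P) \<lparr>regs = R', mem = H'\<rparr> u \<lparr>regs = R'', mem = H''\<rparr>"
      "u \<le> T - (bcost p + 1) - t" "Q R'' H'' (T - (bcost p + 1) - t - u)" unfolding wp_def by blast
    have "exec w (While p P) \<lparr>regs = R, mem = H\<rparr> (bcost p + t + u + 1) \<lparr>regs = R'', mem = H''\<rparr>"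
      by (rule exec.WhileTrue[OF _ t(1) u(1)]) (simp add: bval_eq_bv True)
    moreover have "T - (bcost p + t + u + 1) = T - (bcost p + 1) - t - u" by simp
    ultimately show ?thesis unfolding wp_def using t(2) u(2,3) step(1)[OF less.prems]
      by (intro exI[of _ "bcost p + t + u + 1"] exI[of _ R''] exI[of _ H'']) auto
  next
    case False
    then have "exec w (While p P) \<lparr>regs = R, mem = H\<rparr> (bcost p + 1) \<lparr>regs = R, mem = H\<rparr>"
      by (intro exec.WhileFalse) (simp add: bval_eq_bv)
    then show ?thesis unfolding wp_def using step(1,3)[OF less.prems] False by blast
  qed
qed

lemma wp_conseq:
  "wp P Q R H T \<Longrightarrow> (\<And>R H T. Q R H T \<Longrightarrow> Q' R H T) \<Longrightarrow> wp P Q' R H T"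
  unfolding wp_def by blast

end

abbreviation Mod :: "aexp \<Rightarrow> aexp \<Rightarrow> aexp" where
  "Mod a b \<equiv> Minus a (Times (Div a b) b)"

section \<open>The program\<close>

abbreviation Incr :: "nat \<Rightarrow> com" where
  "Incr r \<equiv> Assign r (Plus (Reg r) (Const 1))"

text \<open>
  Registers 0, 1 and 2 hold \<open>m\<close>, \<open>n\<close> and \<open>W = m * n\<close>; 3 the address \<open>G = 3 * W + 2\<close> of the table;
  4 the base \<open>n + 1\<close>; 5 and 6 the size \<open>(n + 1) ^ (m - 1)\<close> of a level and the number whose \<open>m - 1\<close>
  digits are all 1; 7 the address of the dictionary; 9, 10 and 11 the level, its address and the
  index in it, whose digits are the prefix lengths; 12 the position of the scan. The cells from \<open>W\<close>
  to \<open>G\<close> hold the last scanned occurrence of every letter.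
\<close>

definition dims_prog :: com where
  "dims_prog = Seq (Assign 2 (Times (Reg 0) (Reg 1)))
    (Seq (Assign 3 (Plus (Times (Const 3) (Reg 2)) (Const 2)))
    (Seq (Assign 4 (Plus (Reg 1) (Const 1)))
    (Seq (Assign 5 (Const 1))
    (Seq (Assign 6 (Const 0))
    (Seq (Assign 8 (Const 0))
    (Seq (While (Less (Plus (Reg 8) (Const 1)) (Reg 0))
      (Seq (Assign 6 (Plus (Reg 6) (Reg 5)))
      (Seq (Assign 5 (Times (Reg 5) (Reg 4))) (Incr 8))))
    (Assign 7 (Plus (Reg 3) (Times (Reg 5) (Reg 4))))))))))"

text \<open>
  Letters may be arbitrary words, so a dictionary with one cell per letter would not fit next to the
  other data. Two letters with the same half share a cell, which stores the successor of the address of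
  an occurrence of either; the new name of a letter is twice this number plus the parity of the letter.
\<close>

definition dict_prog :: com where
  "dict_prog = Seq (Assign 8 (Const 0))
    (While (Less (Reg 8) (Reg 2))
      (Seq (Store (Plus (Reg 7) (Div (Load (Reg 8)) (Const 2))) (Plus (Reg 8) (Const 1))) (Incr 8)))"

definition rename_prog :: com where
  "rename_prog = Seq (Assign 8 (Const 0))
    (While (Less (Reg 8) (Reg 2))
      (Seq (Store (Reg 8) (Plus (Times (Const 2) (Load (Plus (Reg 7) (Div (Load (Reg 8)) (Const 2)))))
        (Mod (Load (Reg 8)) (Const 2)))) (Incr 8)))"

definition level0_prog :: com where
  "level0_prog = Seq (Assign 8 (Const 0))
    (While (Less (Reg 8) (Reg 5)) (Seq (Store (Plus (Reg 3) (Reg 8)) (Reg 4)) (Incr 8)))"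

definition clear_prog :: com where
  "clear_prog = Seq (Assign 8 (Const 0))
    (While (Less (Reg 8) (Minus (Reg 3) (Reg 2))) (Seq (Store (Plus (Reg 2) (Reg 8)) (Const 0)) (Incr 8)))"

abbreviation Digit :: aexp where
  "Digit \<equiv> Mod (Div (Reg 11) (Reg 14)) (Reg 4)"

abbreviation Raise :: "nat \<Rightarrow> aexp \<Rightarrow> com" where
  "Raise r a \<equiv> Cond (Less (Reg r) a) (Assign r a) Skip"

definition digits_prog :: com where
  "digits_prog = Seq (Assign 13 (Const 0)) (Seq (Assign 14 (Const 1)) (Seq (Assign 15 (Const 0))
    (Seq (Assign 16 (Const 1)) (Seq (Assign 17 (Load (Minus (Mod (Reg 11) (Reg 4)) (Const 1))))
    (While (Less (Plus (Reg 13) (Const 1)) (Reg 0))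
      (Seq (Cond (Equal Digit (Const 0)) (Assign 16 (Const 0))
        (Seq (Raise 15 (Load (Minus (Plus (Reg 10) (Reg 11)) (Reg 14))))
          (Cond (Equal (Load (Minus (Plus (Times (Reg 13) (Reg 1)) Digit) (Const 1))) (Reg 17))
            Skip (Assign 16 (Const 0)))))
      (Seq (Incr 13) (Assign 14 (Times (Reg 14) (Reg 4))))))))))"

definition scan_prog :: com where
  "scan_prog = While (Less (Reg 12) (Reg 18))
    (Seq (Store (Plus (Reg 2) (Load (Minus (Reg 2) (Reg 12)))) (Reg 12)) (Incr 12))"

definition match_prog :: com where
  "match_prog = Cond (Equal (Reg 16) (Const 1))
    (Seq (Assign 18 (Load (Minus (Plus (Minus (Reg 10) (Reg 5)) (Reg 11)) (Reg 6))))
    (Seq scan_prog (Raise 15 (Load (Plus (Reg 2) (Reg 17)))))) Skip"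

definition cell_prog :: com where
  "cell_prog = Seq (Cond (Equal (Mod (Reg 11) (Reg 4)) (Const 0)) (Seq clear_prog (Assign 12 (Const 1))) Skip)
    (Seq digits_prog (Seq match_prog (Seq (Store (Plus (Reg 10) (Reg 11)) (Reg 15)) (Incr 11))))"

definition level_prog :: com where
  "level_prog = Seq (Incr 9) (Seq (Assign 10 (Plus (Reg 10) (Reg 5))) (Seq (Assign 11 (Const 0))
    (While (Less (Reg 11) (Reg 5)) cell_prog)))"

definition levels_prog :: com where
  "levels_prog = Seq (Assign 9 (Const 0)) (Seq (Assign 10 (Reg 3))
    (Seq (While (Less (Const 0) (Load (Minus (Plus (Reg 10) (Reg 5)) (Const 1)))) level_prog)
    (Assign 0 (Minus (Reg 9) (Const 1)))))"

definition lcs_prog :: com where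
  "lcs_prog = Seq dims_prog (Seq dict_prog (Seq rename_prog (Seq level0_prog levels_prog)))"

locale lcs_layout = word_ram w U for w U +
  fixes M n B W G N D K :: nat
  assumes B_eq: "B = Suc n" and M_pos: "1 \<le> M" and n_pos: "1 \<le> n"
    and W_eq: "W = Suc M * n" and G_eq: "G = 3 * W + 2" and N_eq: "N = B ^ M"
    and D_eq: "D = (\<Sum>i<M. B ^ i)" and K_eq: "K = G + N * B" and K_le: "2 * K \<le> U"
begin

definition dims_ok :: "(nat \<Rightarrow> nat) \<Rightarrow> bool" where
  "dims_ok R \<longleftrightarrow> R 0 = Suc M \<and> R 1 = n \<and> R 2 = W \<and> R 3 = G \<and> R 4 = B \<and> R 5 = N \<and> R 6 = D"

lemma N_pos: "0 < N" by (simp add: N_eq B_eq)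

lemma bounds: "n < W" "Suc M \<le> W" "n < N" "W + 2 \<le> G" "G - W = 2 * W + 2" "G \<le> K" "G + N \<le> K" "K < U" "7 < U" "2 * n \<le> W" "B \<le> N" "0 < B"
proof -
  obtain M' where M': "M = Suc M'" using M_pos by (cases M) auto
  obtain n' where n': "n = Suc n'" using n_pos by (cases n) auto
  show "n < W" by (simp add: W_eq M' n')
  show "2 * n \<le> W" by (simp add: W_eq M')
  show "Suc M \<le> W" by (simp add: W_eq M' n')
  have "B ^ M \<ge> B ^ 1" using M_pos by (intro power_increasing) (auto simp: B_eq)
  then show "n < N" by (simp add: N_eq B_eq)
  show "W + 2 \<le> G" "G - W = 2 * W + 2" by (auto simp: G_eq)
  show "G \<le> K" "G + N \<le> K" by (auto simp: K_eq B_eq)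
  show "K < U" "7 < U" using K_le \<open>n < W\<close> n_pos by (auto simp: G_eq K_eq)
  show "B \<le> N" using \<open>n < N\<close> by (simp add: B_eq)
  show "0 < B" by (simp add: B_eq)
qed

lemma wp_clear:
  assumes R: "dims_ok R" and T: "20 * (2 * W + 2) + 20 + T' \<le> T"
  shows "wp clear_prog (\<lambda>R' H' T''. R' = R(8 := 2 * W + 2) \<and>
    H' = (\<lambda>a. if W \<le> a \<and> a < G then 0 else H a) \<and> T' \<le> T'') R H T"
proof -
  define I where "I = (\<lambda>R' H' T''. \<exists>j\<le>2 * W + 2. R' = R(8 := j) \<and>
    H' = (\<lambda>a. if W \<le> a \<and> a < W + j then 0 else H a) \<and> 20 * (2 * W + 2 - j) + 15 + T' \<le> T'')"
  note b = bounds
  show ?thesis unfolding clear_prog_def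
  proof (rule wp_Seq_Assign, (use T in simp)[1], rule wp_While[where I = I], goal_cases)
    case 1
    show ?case unfolding I_def using T b by (intro exI[of _ 0]) auto
  next
    case (2 R' H' t)
    then show ?case by (auto simp: I_def)
  next
    case (3 R' H' t)
    then obtain j where j: "R' = R(8 := j)"
      "H' = (\<lambda>a. if W \<le> a \<and> a < W + j then 0 else H a)"
      "20 * (2 * W + 2 - j) + 15 + T' \<le> t" unfolding I_def by blast
    have lt: "j < 2 * W + 2" using 3(2) R b(5) by (simp add: j dims_ok_def)
    show ?case
      apply (intro wp_Seq wp_Store wp_Assign)
      using j(3) lt R b by (auto simp: I_def dims_ok_def j(1,2) fun_eq_iff intro!: exI[of _ "Suc j"])
  next
    case (4 R' H' t)
    then obtain j where j: "j \<le> 2 * W + 2" "R' = R(8 := j)"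
      "H' = (\<lambda>a. if W \<le> a \<and> a < W + j then 0 else H a)"
      "20 * (2 * W + 2 - j) + 15 + T' \<le> t" unfolding I_def by blast
    have "j = 2 * W + 2" using 4(2) R b(5) j(1) by (simp add: j(2,3) dims_ok_def)
    then show ?case using j b by (auto simp: G_eq fun_eq_iff)
  qed
qed

lemma wp_level0:
  assumes R: "dims_ok R" and T: "20 * N + 20 + T' \<le> T"
  shows "wp level0_prog (\<lambda>R' H' T''. R' = R(8 := N) \<and>
    H' = (\<lambda>a. if G \<le> a \<and> a < G + N then B else H a) \<and> T' \<le> T'') R H T"
proof -
  define I where "I = (\<lambda>R' H' T''. \<exists>j\<le>N. R' = R(8 := j) \<and>
    H' = (\<lambda>a. if G \<le> a \<and> a < G + j then B else H a) \<and> 20 * (N - j) + 15 + T' \<le> T'')"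
  note b = bounds
  show ?thesis unfolding level0_prog_def
  proof (rule wp_Seq_Assign, (use T in simp)[1], rule wp_While[where I = I], goal_cases)
    case 1
    show ?case unfolding I_def using T b by (intro exI[of _ 0]) auto
  next
    case (2 R' H' t)
    then show ?case by (auto simp: I_def)
  next
    case (3 R' H' t)
    then obtain j where j: "R' = R(8 := j)"
      "H' = (\<lambda>a. if G \<le> a \<and> a < G + j then B else H a)"
      "20 * (N - j) + 15 + T' \<le> t" unfolding I_def by blast
    have lt: "j < N" using 3(2) R b(5) by (simp add: j dims_ok_def)
    show ?case
      apply (intro wp_Seq wp_Store wp_Assign)
      using j(3) lt R b by (auto simp: I_def dims_ok_def j(1,2) fun_eq_iff intro!: exI[of _ "Suc j"])
  next
    case (4 R' H' t)
    then obtain j where j: "j \<le> N" "R' = R(8 := j)"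
      "H' = (\<lambda>a. if G \<le> a \<and> a < G + j then B else H a)"
      "20 * (N - j) + 15 + T' \<le> t" unfolding I_def by blast
    have "j = N" using 4(2) R b(5) j(1) by (simp add: j(2,3) dims_ok_def)
    then show ?case using j b by (auto simp: G_eq fun_eq_iff)
  qed
qed

lemma geometric_le: "(\<Sum>j<i. B ^ j) \<le> B ^ i"
proof (induction i)
  case (Suc i)
  have "2 * B ^ i \<le> B * B ^ i" using n_pos by (intro mult_right_mono) (auto simp: B_eq)
  then have "sum ((^) B) {..<i} + B ^ i \<le> B * B ^ i" using Suc by linarith
  then show ?case by simp
qed simp

lemma wp_dims:
  assumes R: "R 0 = Suc M" "R 1 = n" and T: "40 * M + 70 + T' \<le> T"
  shows "wp dims_prog (\<lambda>R' H' T''. dims_ok R' \<and> R' 7 = K \<and> H' = H \<and> T' \<le> T'') R H T"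
proof -
  define I where "I = (\<lambda>(R' :: nat \<Rightarrow> nat) H' T''. \<exists>i\<le>M. R' 0 = Suc M \<and> R' 1 = n \<and> R' 2 = W \<and> R' 3 = G \<and> R' 4 = B \<and>
    R' 5 = B ^ i \<and> R' 6 = (\<Sum>j<i. B ^ j) \<and> R' 8 = i \<and> H' = H \<and> 40 * (M - i) + 20 + T' \<le> T'')"
  note b = bounds
  have KN: "G + N * B < U" "N * B < U" using b by (simp_all add: K_eq)
  have W': "n + M * n = W" by (simp add: W_eq)
  have WU: "3 * W + 2 < U" "W < U" "3 * W < U" using b by (simp_all add: G_eq)
  have nU: "Suc n < U" "Suc M < U" using b by linarith+
  show ?thesis unfolding dims_prog_def
  proof ((rule wp_Seq_Assign, (use T in simp)[1])+, rule wp_Seq, rule wp_While[where I = I], goal_cases)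
    case 1
    show ?case unfolding I_def
      apply (rule exI[of _ 0])
      using R T WU nU b(9) by (simp add: W' G_eq B_eq)
  next
    case (2 R' H' t)
    then show ?case by (auto simp: I_def)
  next
    case (3 R' H' t)
    then obtain i where i: "i \<le> M" "R' 0 = Suc M" "R' 1 = n" "R' 2 = W" "R' 3 = G" "R' 4 = B"
      "R' 5 = B ^ i" "R' 6 = (\<Sum>j<i. B ^ j)" "R' 8 = i" "H' = H" "40 * (M - i) + 20 + T' \<le> t"
      unfolding I_def by blast
    have lt: "i < M" using 3(2) i nU b(9) by simp
    have "B ^ Suc i \<le> B ^ M" using lt b by (intro power_increasing) auto
    then have pU: "B ^ i * B < U" using b by (simp add: N_eq mult.commute)
    have sU: "(\<Sum>j<i. B ^ j) + B ^ i < U"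
      using geometric_le[of "Suc i"] \<open>B ^ Suc i \<le> B ^ M\<close> b by (simp add: N_eq)
    have iU: "Suc i < U" using lt nU by simp
    show ?case
      apply (intro wp_Seq wp_Assign)
      using i(11) lt apply simp
      using i(11) lt apply simp
      using i(11) lt apply simp
      unfolding I_def
      apply (rule exI[of _ "Suc i"])
      using i lt pU sU iU b(9) by (simp add: mult.commute)
  next
    case (4 R' H' t)
    then obtain i where i: "i \<le> M" "R' 0 = Suc M" "R' 1 = n" "R' 2 = W" "R' 3 = G" "R' 4 = B"
      "R' 5 = B ^ i" "R' 6 = (\<Sum>j<i. B ^ j)" "R' 8 = i" "H' = H" "40 * (M - i) + 20 + T' \<le> t"
      unfolding I_def by blast
    have "i = M" using 4(2) i nU b(9) by simp
    then have i': "R' 5 = N" "R' 6 = D" using i by (simp_all add: N_eq D_eq)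
    show ?case
      apply (rule wp_Assign)
      using i(11) apply simp
      using i(2-6,10,11) i' KN by (simp add: dims_ok_def K_eq)
  qed
qed

lemma wp_dict:
  assumes R: "dims_ok R" "R 7 = K" and H: "\<And>a. a < W \<Longrightarrow> H a < U" and T: "30 * W + 20 + T' \<le> T"
  shows "wp dict_prog (\<lambda>R' H' T''. R' = R(8 := W) \<and> (\<forall>a<K. H' a = H a) \<and>
    (\<forall>a<W. \<exists>i<W. H' (K + H a div 2) = Suc i \<and> H i div 2 = H a div 2) \<and> T' \<le> T'') R H T"
proof -
  define I where "I = (\<lambda>R' H' T''. \<exists>j\<le>W. R' = R(8 := j) \<and> (\<forall>a<K. H' a = H a) \<and>
    (\<forall>a<j. \<exists>i<W. H' (K + H a div 2) = Suc i \<and> H i div 2 = H a div 2) \<and> 30 * (W - j) + 10 + T' \<le> T'')"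
  note b = bounds
  note r = R(1)[unfolded dims_ok_def]
  show ?thesis unfolding dict_prog_def
  proof (rule wp_Seq_Assign, (use T in simp)[1], rule wp_While[where I = I], goal_cases)
    case 1
    show ?case unfolding I_def using T b(9) by (intro exI[of _ 0]) simp
  next
    case (2 R' H' t)
    then show ?case by (auto simp: I_def)
  next
    case (3 R' H' t)
    then obtain j where j: "j \<le> W" "R' = R(8 := j)" "\<And>a. a < K \<Longrightarrow> H' a = H a"
      "\<And>a. a < j \<Longrightarrow> \<exists>i<W. H' (K + H a div 2) = Suc i \<and> H i div 2 = H a div 2"
      "30 * (W - j) + 10 + T' \<le> t" unfolding I_def by blast
    have lt: "j < W" using 3(2) r by (simp add: j)
    have hj: "H' j = H j" using lt j b by simp
    have aU: "K + H j div 2 < U" using H[OF lt] K_le by linarith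
    have jU: "Suc j < U" using lt b by linarith
    have IS: "I (R(8 := Suc j)) (H'(K + H j div 2 := Suc j)) t'" if "30 * (W - Suc j) + 10 + T' \<le> t'" for t'
    proof -
      have "\<exists>i<W. (H'(K + H j div 2 := Suc j)) (K + H a div 2) = Suc i \<and> H i div 2 = H a div 2" if "a < Suc j" for a
      proof (cases "H a div 2 = H j div 2")
        case True
        then show ?thesis using lt by (intro exI[of _ j]) simp
      next
        case False
        then have "a < j" using that by (cases "a = j") auto
        from j(4)[OF this] False show ?thesis by auto
      qed
      then show ?thesis unfolding I_def using that lt j(3) by (intro exI[of _ "Suc j"]) simp
    qed
    have ev: "(H'(av U R' H' (Plus (Reg 7) (Div (Load (Reg 8)) (Const 2))) := av U R' H' (Plus (Reg 8) (Const 1)))) =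
      H'(K + H j div 2 := Suc j)" "R'(8 := av U R' h (Plus (Reg 8) (Const 1))) = R(8 := Suc j)" for h
      using R hj aU jU b(9) by (simp_all add: j(2))
    show ?case
      apply (intro wp_Seq wp_Assign wp_Store)
      using j(5) lt apply simp
      using j(5) lt apply simp
      unfolding ev
      by (rule IS) (use j(5) lt in simp)
  next
    case (4 R' H' t)
    then obtain j where j: "j \<le> W" "R' = R(8 := j)" "\<And>a. a < K \<Longrightarrow> H' a = H a"
      "\<And>a. a < j \<Longrightarrow> \<exists>i<W. H' (K + H a div 2) = Suc i \<and> H i div 2 = H a div 2"
      "30 * (W - j) + 10 + T' \<le> t" unfolding I_def by blast
    have "j = W" using 4(2) r j(1) by (simp add: j(2))
    then show ?case using j by simp
  qed
qed

lemma wp_rename: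
  assumes R: "dims_ok R" "R 7 = K" and H: "\<And>a. a < W \<Longrightarrow> H a < U"
    and D: "\<And>a. a < W \<Longrightarrow> H (K + H a div 2) \<le> W" and T: "40 * W + 20 + T' \<le> T"
  shows "wp rename_prog (\<lambda>R' H' T''. R' = R(8 := W) \<and>
    H' = (\<lambda>a. if a < W then 2 * H (K + H a div 2) + H a mod 2 else H a) \<and> T' \<le> T'') R H T"
proof -
  define f where "f = (\<lambda>a. 2 * H (K + H a div 2) + H a mod 2)"
  define I where "I = (\<lambda>R' H' T''. \<exists>j\<le>W. R' = R(8 := j) \<and>
    H' = (\<lambda>a. if a < j then f a else H a) \<and> 40 * (W - j) + 10 + T' \<le> T'')"
  note b = bounds
  note r = R(1)[unfolded dims_ok_def]
  show ?thesis unfolding rename_prog_def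
  proof (rule wp_Seq_Assign, (use T in simp)[1], rule wp_While[where I = I], goal_cases)
    case 1
    show ?case unfolding I_def using T b(9) by (intro exI[of _ 0]) simp
  next
    case (2 R' H' t)
    then show ?case by (auto simp: I_def)
  next
    case (3 R' H' t)
    then obtain j where j: "j \<le> W" "R' = R(8 := j)" "H' = (\<lambda>a. if a < j then f a else H a)"
      "40 * (W - j) + 10 + T' \<le> t" unfolding I_def by blast
    have lt: "j < W" using 3(2) r by (simp add: j(2))
    have IS: "I (R(8 := Suc j)) (H'(j := f j)) t'" if "40 * (W - Suc j) + 10 + T' \<le> t'" for t'
      unfolding I_def using that lt j(3) by (intro exI[of _ "Suc j"]) (auto simp: fun_eq_iff)
    have aU: "K + H j div 2 < U" using H[OF lt] K_le by linarith
    have jU: "Suc j < U" using lt b by linarith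
    have hj: "H' j = H j" "H' (K + H j div 2) = H (K + H j div 2)" using lt b by (simp_all add: j(3))
    have fU: "2 * H (K + H j div 2) < U" "f j < U" using D[OF lt] b by (simp_all add: f_def G_eq)
    have m: "H j - H j div 2 * 2 = H j mod 2" by (simp add: minus_div_mult_eq_mod)
    have dU: "H j div 2 * 2 < U" using H[OF lt] by linarith
    have c2: "2 mod U = 2" using b(9) by simp
    have ev1: "av U R' H' (Plus (Times (Const 2) (Load (Plus (Reg 7) (Div (Load (Reg 8)) (Const 2)))))
        (Mod (Load (Reg 8)) (Const 2))) = f j"
      unfolding av.simps c2 using R hj aU jU fU dU by (simp add: j(2) m f_def)
    have ev: "R'(8 := av U R' h (Plus (Reg 8) (Const 1))) = R(8 := Suc j)" "av U R' h (Reg 8) = j" for h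
      using jU b(9) by (simp_all add: j(2))
    show ?case
      apply (intro wp_Seq wp_Assign wp_Store)
      using j(4) lt apply simp
      using j(4) lt apply simp
      unfolding ev ev1
      by (rule IS) (use j(4) lt in simp)
  next
    case (4 R' H' t)
    then obtain j where j: "j \<le> W" "R' = R(8 := j)" "H' = (\<lambda>a. if a < j then f a else H a)"
      "40 * (W - j) + 10 + T' \<le> t" unfolding I_def by blast
    have "j = W" using 4(2) r j(1) by (simp add: j(2))
    then show ?case using j by (auto simp: f_def fun_eq_iff)
  qed
qed

end

locale lcs_run = lcs_layout w U M n B W G N D K + strings S Z M n B
  for w U M n B W G N D K S Z +
  fixes s :: "nat \<Rightarrow> nat"
  assumes s_S: "i < M \<Longrightarrow> j < n \<Longrightarrow> s (i * n + j) = S i ! j"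
    and s_Z: "j < n \<Longrightarrow> s (M * n + j) = Z ! j"
    and s_bound: "a < W \<Longrightarrow> s a < 2 * W + 2"
begin

lemma s_last: "1 \<le> q \<Longrightarrow> q \<le> n \<Longrightarrow> s (W - q) = Z ! (n - q)"
  using s_Z[of "n - q"] by (simp add: W_eq add.commute)

lemma wp_scan:
  assumes R: "dims_ok R" and H: "\<And>a. a < W \<Longrightarrow> H a = s a"
    and pos: "\<And>c. c < 2 * W + 2 \<Longrightarrow> H (W + c) = scan (R 12) c"
    and q: "1 \<le> R 12" "R 12 \<le> Suc n" "R 18 \<le> Suc n"
    and T: "20 * (max (R 12) (R 18) - R 12) + 10 + T' \<le> T"
  shows "wp scan_prog (\<lambda>R' H' T''. R' = R(12 := max (R 12) (R 18)) \<and>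
    H' = (\<lambda>a. if W \<le> a \<and> a < G then scan (max (R 12) (R 18)) (a - W) else H a) \<and> T' \<le> T'') R H T"
proof -
  define m where "m = max (R 12) (R 18)"
  define I where "I = (\<lambda>R' H' T''. \<exists>q. R 12 \<le> q \<and> q \<le> m \<and> R' = R(12 := q) \<and>
    H' = (\<lambda>a. if W \<le> a \<and> a < G then scan q (a - W) else H a) \<and> 20 * (m - q) + 10 + T' \<le> T'')"
  note b = bounds
  have mn: "m \<le> Suc n" using q by (simp add: m_def)
  show ?thesis unfolding scan_prog_def m_def[symmetric]
  proof (rule wp_While[where I = I])
    have "H (W + (a - W)) = scan (R 12) (a - W)" if "W \<le> a" "a < G" for a
      using that b by (intro pos) (auto simp: G_eq)
    then show "I R H T" unfolding I_def using T by (intro exI[of _ "R 12"]) (auto simp: m_def fun_eq_iff)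
  next
    fix R' H' T'' assume I: "I R' H' T''"
    then obtain q' where q': "R 12 \<le> q'" "q' \<le> m" "R' = R(12 := q')"
      "H' = (\<lambda>a. if W \<le> a \<and> a < G then scan q' (a - W) else H a)"
      "20 * (m - q') + 10 + T' \<le> T''" unfolding I_def by blast
    show "bcost (Less (Reg 12) (Reg 18)) + 1 \<le> T''" using q'(5) by simp
    { assume "bv U R' H' (Less (Reg 12) (Reg 18))"
      then have lt: "q' < m" by (simp add: q' m_def)
      have s: "H' (W - q') = Z ! (n - q')" "s (W - q') = Z ! (n - q')" "Z ! (n - q') < 2 * W + 2"
        using s_last[of q'] s_bound[of "W - q'"] H[of "W - q'"] q q' lt mn b by (auto simp: q'(4))
      have upd: "H'(W + Z ! (n - q') := q') = (\<lambda>a. if W \<le> a \<and> a < G then scan (Suc q') (a - W) else H a)"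
        using s(3) b by (auto simp: q'(4) fun_eq_iff)
      have sm: "W + Z ! (n - q') < U" "Suc q' < U" using s(3) lt mn b by auto
      have IS: "I R0 H0 (t::nat)" if "R0 = R(12 := Suc q')" "H0 = H'(W + Z ! (n - q') := q')"
        "20 * (m - Suc q') + 10 + T' \<le> t" for R0 H0 t
        unfolding I_def using that q'(1) lt upd by (intro exI[of _ "Suc q'"]) simp
      have t: "20 * (m - Suc q') + 30 + T' \<le> T''" using q'(5) lt by linarith
      show "wp (Seq (Store (Plus (Reg 2) (Load (Minus (Reg 2) (Reg 12)))) (Reg 12)) (Incr 12)) I R' H'
        (T'' - (bcost (Less (Reg 12) (Reg 18)) + 1))"
        apply (intro wp_Seq wp_Store wp_Assign IS)
        using R b(8,9) s(1) sm t by (simp_all add: dims_ok_def q'(3)) }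
    { assume "\<not> bv U R' H' (Less (Reg 12) (Reg 18))"
      then have "q' = m" using q'(1,2) by (auto simp: q'(3) m_def)
      then show "R' = R(12 := m) \<and> H' = (\<lambda>a. if W \<le> a \<and> a < G then scan m (a - W) else H a) \<and>
        T' \<le> T'' - (bcost (Less (Reg 12) (Reg 18)) + 1)"
        using q' by auto }
  qed
qed

lemma wp_digits:
  assumes R: "dims_ok R" "R 10 = C" "R 11 = x" and H: "\<And>a. a < W \<Longrightarrow> H a = s a"
    and x: "x < N" and C: "C + N \<le> K"
    and tab: "\<And>y. y < x \<Longrightarrow> H (C + y) = gval k (dig y)"
    and T: "100 * M + 50 + T' \<le> T" and a: "a = s (dig x 0 - 1)"
  shows "wp digits_prog (\<lambda>R' H' T''. R' = R(13 := M, 14 := N, 15 := best k x M,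
      16 := if matches x a M then 1 else 0, 17 := a) \<and> H' = H \<and> T' \<le> T'') R H T"
proof -
  define J where "J = (\<lambda>i. R(13 := i, 14 := B ^ i, 15 := best k x i,
      16 := if matches x a i then 1 else 0, 17 := a))"
  define I where "I = (\<lambda>R' H' T''. \<exists>i\<le>M. R' = J i \<and> H' = H \<and> 100 * (M - i) + 20 + T' \<le> T'')"
  note b = bounds
  note r = R(1)[unfolded dims_ok_def]
  have d0: "x - x div B * B = dig x 0" by (simp add: digit_def minus_div_mult_eq_mod)
  have xB: "x div B * B < U" using x b C by (meson div_times_less_eq_dividend le_less_trans less_le_trans less_imp_le add_leD2)
  have a0: "H (dig x 0 - 1) = a" using H[of "dig x 0 - 1"] dig_le[of 0 x] b a by simp
  show ?thesis unfolding digits_prog_def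
  proof ((rule wp_Seq_Assign, (use T in simp)[1])+, rule wp_While[where I = I], goal_cases)
    case 1
    show ?case unfolding I_def J_def
      using T r R b d0 xB a0 by (intro exI[of _ 0]) (auto simp: matches_def fun_eq_iff)
  next
    case (2 R' H' T'')
    then show ?case by (auto simp: I_def)
  next
    case (3 R' H' T'')
    then obtain i where i: "i \<le> M" "R' = J i" "H' = H" "100 * (M - i) + 20 + T' \<le> T''"
      unfolding I_def by blast
    have lt: "i < M" using 3(2) r b i(1) by (simp add: i(2,3) J_def)
    define pw where "pw = B ^ i"
    define d where "d = dig x i"
    have "B ^ Suc i \<le> B ^ M" using lt b by (intro power_increasing) auto
    then have pwB: "pw * B < U" using b by (simp add: pw_def N_eq mult.commute)
    have pw0: "0 < pw" using b by (simp add: pw_def)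
    have dE: "x div pw - x div pw div B * B = d"
      by (simp add: d_def pw_def digit_def minus_div_mult_eq_mod)
    have xU: "C + x < U" using x C b by linarith
    have "x div pw div B * B \<le> x" by (meson div_le_dividend div_times_less_eq_dividend order_trans)
    then have dU: "x div pw div B * B < U" using xU by linarith
    have dn: "d \<le> n" by (simp add: d_def dig_le)
    have "Suc i * n \<le> M * n" using lt by (intro mult_right_mono) auto
    then have iW: "i * n + n + n \<le> W" by (simp add: W_eq)
    then have iU: "i * n + d < U" "i * n < U" using dn b by linarith+
    have pos: "pw \<le> x" "H (C + x - pw) = gval k (dig (x - pw))"
      "H (i * n + d - Suc 0) = S i ! (d - 1)" if "0 < d"
    proof -
      show px: "pw \<le> x" using digit_diff_power(2)[OF x[unfolded N_eq] lt _ lt] that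
        by (simp add: pw_def d_def)
      then show "H (C + x - pw) = gval k (dig (x - pw))" using tab[of "x - pw"] pw0 by simp
      have "H (i * n + (d - 1)) = S i ! (d - 1)"
        using H[of "i * n + (d - 1)"] s_S[OF lt, of "d - 1"] that dn iW by simp
      then show "H (i * n + d - Suc 0) = S i ! (d - 1)" using that by simp
    qed
    have JS: "J (Suc i) = R(13 := Suc i, 14 := pw * B,
      15 := if d = 0 then best k x i else max (best k x i) (gval k (dig (x - pw))),
      16 := if matches x a i \<and> 0 < d \<and> S i ! (d - 1) = a then 1 else 0, 17 := a)"
      by (auto simp: J_def pw_def d_def matches_def less_Suc_eq fun_eq_iff mult.commute)
    define f where "f = (if matches x a i then 1 else 0 :: nat)"
    define v where "v = best k x i"
    define v' where "v' = max v (gval k (dig (x - pw)))"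
    have J: "R' = R(13 := i, 14 := pw, 15 := v, 16 := f, 17 := a)"
      by (simp add: i(2) J_def pw_def f_def v_def)
    have JS0: "J (Suc i) = R(13 := Suc i, 14 := pw * B, 15 := v, 16 := 0, 17 := a)" if "d = 0"
      using that JS by (simp add: v_def)
    have JS1: "J (Suc i) = R(13 := Suc i, 14 := pw * B, 15 := v', 16 := f, 17 := a)"
      if "0 < d" "S i ! (d - 1) = a" using that JS by (simp add: f_def v_def v'_def)
    have JS2: "J (Suc i) = R(13 := Suc i, 14 := pw * B, 15 := v', 16 := 0, 17 := a)"
      if "0 < d" "S i ! (d - 1) \<noteq> a" using that JS by (simp add: v_def v'_def)
    have IS: "I R0 H (t::nat)" if "R0 = J (Suc i)" "100 * (M - Suc i) + 20 + T' \<le> t" for R0 t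
      unfolding I_def using that lt by (intro exI[of _ "Suc i"]) simp
    have t: "100 * (M - Suc i) + 120 + T' \<le> T''" using i(4) lt by linarith
    have iM: "Suc i < U" "i < U" using lt b by linarith+
    show ?case
    proof (cases "d = 0")
      case True
      show ?thesis unfolding i(3) J
        apply (rule wp_Seq, rule wp_Cond_True)
        using dE dU r R True apply simp
        using t apply simp
        apply (intro wp_Seq wp_Assign IS)
        unfolding JS0[OF True]
        using t iM pwB r b(8,9) by (simp_all add: fun_eq_iff)
    next
      case False
      then have d0: "0 < d" by simp
      note p = pos[OF d0]
      show ?thesis unfolding i(3) J
        apply (rule wp_Seq, rule wp_Cond_False)
        using dE dU r R False apply simp
        using t apply simp
        apply (rule wp_Seq, rule wp_Raise)
        using t apply simp
      proof goal_cases
        case (1 t')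
        have t': "100 * (M - Suc i) + 70 + T' \<le> t'" using 1(1) t by simp
        have st: "R(13 := i, 14 := pw, 15 := v, 16 := f, 17 := a, 15 := max ((R(13 := i, 14 := pw, 15 := v, 16 := f, 17 := a)) 15)
          (av U (R(13 := i, 14 := pw, 15 := v, 16 := f, 17 := a)) H (Load (Minus (Plus (Reg 10) (Reg 11)) (Reg 14))))) =
          R(13 := i, 14 := pw, 15 := v', 16 := f, 17 := a)"
          using xU R(2,3) p(2) by (simp add: fun_eq_iff v'_def)
        show ?case unfolding st
        proof (cases "S i ! (d - 1) = a")
          case True
          show "wp (Cond
            (Equal (Load (Minus (Plus (Times (Reg 13) (Reg 1)) Digit) (Const 1))) (Reg 17))
            Skip (Assign 16 (Const 0)))
            (wp (Seq (Incr 13) (Assign 14 (Times (Reg 14) (Reg 4)))) I)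
            (R(13 := i, 14 := pw, 15 := v', 16 := f, 17 := a)) H t'"
            apply (rule wp_Cond_True)
            using dE dU iU r R b(8,9) p(3) True apply simp
            using t' apply simp
            apply (intro wp_Seq wp_Skip wp_Assign IS)
            unfolding JS1[OF d0 True]
            using t' iM pwB r b(8,9) by (simp_all add: fun_eq_iff)
        next
          case False
          show "wp (Cond
            (Equal (Load (Minus (Plus (Times (Reg 13) (Reg 1)) Digit) (Const 1))) (Reg 17))
            Skip (Assign 16 (Const 0)))
            (wp (Seq (Incr 13) (Assign 14 (Times (Reg 14) (Reg 4)))) I)
            (R(13 := i, 14 := pw, 15 := v', 16 := f, 17 := a)) H t'"
            apply (rule wp_Cond_False)
            using dE dU iU r R b(8,9) p(3) False apply simp
            using t' apply simp
            apply (intro wp_Seq wp_Assign IS)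
            unfolding JS2[OF d0 False]
            using t' iM pwB r b(8,9) by (simp_all add: fun_eq_iff)
        qed
      qed
    qed
  next
    case (4 R' H' T'')
    then obtain i where i: "i \<le> M" "R' = J i" "H' = H" "100 * (M - i) + 20 + T' \<le> T''"
      unfolding I_def by blast
    have "i = M" using 4(2) r b i(1) by (simp add: i(2,3) J_def)
    then show ?case using i by (simp add: J_def N_eq)
  qed
qed

lemma wp_match:
  assumes R: "dims_ok R" "R 10 = C + N" "R 11 = x" "R 15 = best (Suc k) x M"
      "R 16 = (if matches x a M then 1 else 0)" "R 17 = a" and a: "a = s (dig x 0 - 1)"
    and H: "\<And>a. a < W \<Longrightarrow> H a = s a" and x: "x < N" and C: "C + N + N \<le> K" "G \<le> C"
    and tab: "\<And>y. y < N \<Longrightarrow> H (C + y) = gval k (dig y)"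
    and pos: "\<And>c. c < 2 * W + 2 \<Longrightarrow> H (W + c) = scan (R 12) c"
    and q: "1 \<le> R 12" "R 12 \<le> max 1 (gval k (\<lambda>i. dig x i - 1))"
    and T: "20 * (Suc n - R 12) + 60 + T' \<le> T"
  shows "wp match_prog (\<lambda>R' H' T''. \<exists>q g. R' = R(12 := q, 15 := gval (Suc k) (dig x), 18 := g) \<and>
    (\<forall>a. \<not> (W \<le> a \<and> a < G) \<longrightarrow> H' a = H a) \<and> (\<forall>c<2 * W + 2. H' (W + c) = scan q c) \<and>
    1 \<le> q \<and> q \<le> max 1 (gval k (\<lambda>i. dig x i - 1)) \<and> 20 * (Suc n - q) + T' \<le> T'') R H T"
    (is "wp _ ?Q R H T")
proof -
  note b = bounds
  note r = R(1)[unfolded dims_ok_def]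
  have dn: "dig x 0 - 1 < n" using dig_le[of 0 x] n_pos by linarith
  have aS: "a = S 0 ! (dig x 0 - 1)" using s_S[of 0 "dig x 0 - 1"] dn M_pos a by simp
  have aW: "a < 2 * W + 2" unfolding a using dn b by (intro s_bound) simp
  note rec = gval_Suc[OF x[unfolded N_eq] aS, of k]
  show ?thesis
  proof (cases "matches x a M")
    case False
    then have g: "gval (Suc k) (dig x) = R 15" using rec R(4) by simp
    show ?thesis unfolding match_prog_def
      apply (intro wp_Cond_False wp_Skip)
      using R(5) False b(9) apply simp
      using T apply simp
      using T apply simp
      apply (rule exI[of _ "R 12"], rule exI[of _ "R 18"])
      unfolding g using pos q T by (simp add: fun_eq_iff)
  next
    case True
    define g where "g = gval k (dig (x - D))"
    define h where "h = max 1 g"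
    have gD: "g = gval k (\<lambda>i. dig x i - 1)"
      unfolding g_def D_eq using True x by (intro gval_diff_repunit) (auto simp: N_eq matches_def)
    have Dx: "D \<le> x"
      unfolding D_eq using True x M_pos
      by (intro digit_diff_repunit(2)[where j = 0 and M = M]) (auto simp: N_eq matches_def)
    have hq: "max (R 12) g = h" using q gD by (auto simp: h_def max_def split: if_splits)
    have gn: "g \<le> Suc n" "h \<le> Suc n" using gval_le by (auto simp: g_def h_def)
    have qh: "R 12 \<le> h" using hq by auto
    have "scan h a = scan g a" by (cases "g = 0") (auto simp: h_def max_def)
    then have gS: "gval (Suc k) (dig x) = max (R 15) (scan h a)"
      using rec True R(4) by (simp add: g_def D_eq)
    have ld: "H (C + N - N + x - D) = g" using tab[of "x - D"] x Dx by (simp add: g_def)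
    define R1 where "R1 = R(18 := g)"
    have c1: "C + N - N + x < U" using x C b by linarith
    have scan: "wp scan_prog (\<lambda>R' H' T''. R' = R1(12 := h) \<and>
      H' = (\<lambda>a. if W \<le> a \<and> a < G then scan h (a - W) else H a) \<and> 20 * (Suc n - h) + 20 + T' \<le> T'') R1 H t"
      if "20 * (Suc n - R 12) + 35 + T' \<le> t" for t
    proof -
      have mx: "max (R1 12) (R1 18) = h" using hq by (simp add: R1_def)
      show ?thesis
        by (rule wp_scan[where R = R1 and H = H, unfolded mx])
          (use R(1) H pos q gn qh that in \<open>auto simp: R1_def dims_ok_def\<close>)
    qed
    show ?thesis unfolding match_prog_def
    proof (rule wp_Cond_True, goal_cases)
      case 1
      show ?case using R(5) True b(9) by simp
    next
      case 2
      show ?case using T by simp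
    next
      case 3
      have e: "R(18 := av U R H (Load (Minus (Plus (Minus (Reg 10) (Reg 5)) (Reg 11)) (Reg 6)))) = R1"
        using R(2,3) r c1 ld by (simp add: R1_def)
      show ?case
      proof (rule wp_Seq_Assign, goal_cases)
        case 1
        show ?case using T by simp
      next
        case 2
        show ?case unfolding e
        proof (rule wp_Seq, rule wp_conseq[OF scan], goal_cases)
          case 1
          show ?case using T by simp
        next
          case (2 R' H' t)
          then have R': "R' = R1(12 := h)" "H' = (\<lambda>a. if W \<le> a \<and> a < G then scan h (a - W) else H a)"
            and t: "20 * (Suc n - h) + 20 + T' \<le> t" by auto
          have Wa: "W + a < U" "W + a < G" using aW b by linarith+
          then have ev: "av U R' H' (Load (Plus (Reg 2) (Reg 17))) = scan h a"
            using r R(6) by (simp add: R' R1_def)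
          show ?case
            apply (rule wp_Raise)
            using t apply simp
            apply (rule exI[of _ h], rule exI[of _ g])
            unfolding ev gS
            using t b qh q(1) gD by (auto simp: R' R1_def fun_eq_iff h_def G_eq)
        qed
      qed
    qed
  qed
qed

definition cell_inv :: "nat \<Rightarrow> nat \<Rightarrow> (nat \<Rightarrow> nat) \<Rightarrow> (nat \<Rightarrow> nat) \<Rightarrow> bool" where
  "cell_inv k x R H \<longleftrightarrow> dims_ok R \<and> R 9 = Suc k \<and> R 10 = G + k * N + N \<and> R 11 = x \<and>
    (\<forall>a<W. H a = s a) \<and> (\<forall>y<N. H (G + k * N + y) = gval k (dig y)) \<and>
    (\<forall>y<x. H (G + k * N + N + y) = gval (Suc k) (dig y)) \<and>
    (x mod B \<noteq> 0 \<longrightarrow> 1 \<le> R 12 \<and> R 12 \<le> max 1 (gval k (\<lambda>i. dig x i - 1)) \<and>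
      (\<forall>c<2 * W + 2. H (W + c) = scan (R 12) c))"

text \<open>
  The amortised cost of the rest of a level: the entries, the line starts, where the array of
  occurrences is cleared and the scan restarted, and the rest of the current scan.
\<close>

definition cell_fuel :: "nat \<Rightarrow> nat \<Rightarrow> nat" where
  "cell_fuel x q = (100 * M + 200) * (N - x) + (40 * W + 20 * n + 100) * ((N - x) div B) + 20 * (Suc n - q)"

lemma line_start_count:
  assumes "x < N"
  shows "(N - Suc x) div B + (if x mod B = 0 then 1 else 0) \<le> (N - x) div B"
proof (cases "x mod B = 0")
  case True
  have "B dvd N" unfolding N_eq using M_pos by (simp add: dvd_power)
  then have "B dvd N - x" using True by (simp add: dvd_diff_nat mod_eq_0_iff_dvd)
  then obtain j where j: "N - x = B * j" by blast
  have "N - Suc x < j * B" using j assms by (simp add: mult.commute)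
  then have "(N - Suc x) div B < j" by (simp add: less_mult_imp_div_less)
  then show ?thesis using True j bounds by simp
next
  case False
  then show ?thesis by (simp add: div_le_mono)
qed

lemma wp_cell:
  assumes I: "cell_inv k x R H" and x: "x < N" and k: "k < n" and T: "cell_fuel x (R 12) + T' \<le> T"
  shows "wp cell_prog (\<lambda>R' H' T''. cell_inv k (Suc x) R' H' \<and> cell_fuel (Suc x) (R' 12) + T' \<le> T'') R H T"
proof -
  note b = bounds
  define C where "C = G + k * N"
  define a where "a = s (dig x 0 - 1)"
  define h where "h = max 1 (gval k (\<lambda>i. dig x i - 1))"
  define F where "F = (100 * M + 200) * (N - Suc x) + (40 * W + 20 * n + 100) * ((N - Suc x) div B)"
  have "(k + 2) * N \<le> B * N" using k by (intro mult_right_mono) (auto simp: B_eq)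
  then have C: "C + N + N \<le> K" "G \<le> C" by (auto simp: C_def K_eq algebra_simps)
  have N: "N - x = Suc (N - Suc x)" using x by simp
  have F1: "cell_fuel x q' \<ge> F + 100 * M + 200 + 20 * (Suc n - q')" for q'
    using mult_le_mono2[OF line_start_count[OF x], of "40 * W + 20 * n + 100"]
    by (simp add: cell_fuel_def F_def N algebra_simps)
  have F0: "cell_fuel x q' \<ge> F + 100 * M + 200 + 40 * W + 20 * n + 100" if "x mod B = 0" for q'
    using mult_le_mono2[OF line_start_count[OF x], of "40 * W + 20 * n + 100"] that
    by (simp add: cell_fuel_def F_def N algebra_simps)
  define J where "J = (\<lambda>R H t. dims_ok R \<and> R 9 = Suc k \<and> R 10 = C + N \<and> R 11 = x \<and>
    (\<forall>a<W. H a = s a) \<and> (\<forall>y<N. H (C + y) = gval k (dig y)) \<and>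
    (\<forall>y<x. H (C + N + y) = gval (Suc k) (dig y)) \<and>
    1 \<le> R 12 \<and> R 12 \<le> h \<and> (\<forall>c<2 * W + 2. H (W + c) = scan (R 12) c) \<and>
    F + 100 * M + 180 + 20 * (Suc n - R 12) + T' \<le> t)"
  have first: "wp (Cond (Equal (Mod (Reg 11) (Reg 4)) (Const 0)) (Seq clear_prog (Assign 12 (Const 1))) Skip) J R H T"
  proof -
    have xB: "x div B * B < U" by (rule le_less_trans[OF div_times_less_eq_dividend]) (use x b in linarith)
    have ev: "av U R H (Mod (Reg 11) (Reg 4)) = x mod B" "av U R H (Const 0) = 0"
      using I xB b by (simp_all add: cell_inv_def dims_ok_def minus_div_mult_eq_mod)
    show ?thesis
    proof (cases "x mod B = 0")
      case True
      have clr: "wp clear_prog (\<lambda>R' H' T''. R' = R(8 := 2 * W + 2) \<and>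
        H' = (\<lambda>a. if W \<le> a \<and> a < G then 0 else H a) \<and> F + 100 * M + 200 + 20 * n + T' \<le> T'') R H
        (T - (bcost (Equal (Mod (Reg 11) (Reg 4)) (Const 0)) + 1))"
        using T F0[OF True, of "R 12"] I by (intro wp_clear) (auto simp: cell_inv_def)
      show ?thesis
      proof (intro wp_Cond_True wp_Seq wp_conseq[OF clr] wp_Assign, goal_cases)
        case 1
        show ?case using ev True by simp
      next
        case 2
        show ?case using T F1[of "R 12"] by simp
      next
        case (3 R' H' t)
        then show ?case by simp
      next
        case (4 R' H' t)
        then have R': "R' = R(8 := 2 * W + 2)" "H' = (\<lambda>a. if W \<le> a \<and> a < G then 0 else H a)"
          and t: "F + 100 * M + 200 + 20 * n + T' \<le> t" by auto
        show ?case using I t b C(2) unfolding J_def cell_inv_def R'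
          by (simp add: dims_ok_def C_def h_def) (auto simp: G_eq)
      qed
    next
      case False
      then show ?thesis
        apply (intro wp_Cond_False wp_Skip)
        using ev apply simp
        using T F1[of "R 12"] apply simp
        using T F1[of "R 12"] apply simp
        using I T F1[of "R 12"] unfolding J_def cell_inv_def by (simp add: C_def h_def)
    qed
  qed
  show ?thesis unfolding cell_prog_def
  proof (rule wp_Seq, rule wp_conseq[OF first], goal_cases)
    case (1 R1 H1 t1)
    then have R1: "dims_ok R1" "R1 9 = Suc k" "R1 10 = C + N" "R1 11 = x" "\<And>a. a < W \<Longrightarrow> H1 a = s a"
      "\<And>y. y < N \<Longrightarrow> H1 (C + y) = gval k (dig y)" "\<And>y. y < x \<Longrightarrow> H1 (C + N + y) = gval (Suc k) (dig y)"
      "1 \<le> R1 12" "R1 12 \<le> h" "\<And>c. c < 2 * W + 2 \<Longrightarrow> H1 (W + c) = scan (R1 12) c"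
      and t1: "100 * M + 50 + (20 * (Suc n - R1 12) + 60 + (F + 50 + T')) \<le> t1"
      unfolding J_def by auto
    have "wp digits_prog (\<lambda>R' H' T''. R' = R1(13 := M, 14 := N, 15 := best (Suc k) x M,
        16 := if matches x a M then 1 else 0, 17 := a) \<and> H' = H1 \<and>
        20 * (Suc n - R1 12) + 60 + (F + 50 + T') \<le> T'') R1 H1 t1"
      by (rule wp_digits[OF R1(1,3,4) _ x C(1) _ t1 a_def]) (use R1 in auto)
    then show ?case
    proof (rule wp_Seq[OF wp_conseq], goal_cases)
      case (1 R2 H2 t2)
      define v where "v = gval (Suc k) (dig x)"
      have R2: "R2 = R1(13 := M, 14 := N, 15 := best (Suc k) x M,
        16 := if matches x a M then 1 else 0, 17 := a)" "H2 = H1"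
        and t2: "20 * (Suc n - R2 12) + 60 + (F + 50 + T') \<le> t2" using 1 by auto
      have "wp match_prog (\<lambda>R' H' T''. \<exists>q g. R' = R2(12 := q, 15 := gval (Suc k) (dig x), 18 := g) \<and>
        (\<forall>a. \<not> (W \<le> a \<and> a < G) \<longrightarrow> H' a = H2 a) \<and> (\<forall>c<2 * W + 2. H' (W + c) = scan q c) \<and>
        1 \<le> q \<and> q \<le> max 1 (gval k (\<lambda>i. dig x i - 1)) \<and> 20 * (Suc n - q) + (F + 50 + T') \<le> T'') R2 H2 t2"
        by (rule wp_match[where C = C and a = a])
          (use R1 x C t2 a_def in \<open>simp_all add: R2 dims_ok_def h_def\<close>)
      then show ?case
      proof (rule wp_Seq[OF wp_conseq], goal_cases)
        case (1 R3 H3 t3)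
        then obtain q g where R3: "R3 = R2(12 := q, 15 := v, 18 := g)"
          and H3: "\<And>a. \<not> (W \<le> a \<and> a < G) \<Longrightarrow> H3 a = H1 a" "\<And>c. c < 2 * W + 2 \<Longrightarrow> H3 (W + c) = scan q c"
          and q: "1 \<le> q" "q \<le> h" "20 * (Suc n - q) + (F + 50 + T') \<le> t3"
          unfolding v_def h_def R2(2) by blast
        have dims: "dims_ok R3" using R1(1) by (simp add: R3 R2 dims_ok_def)
        have r: "R3 9 = Suc k" "R3 10 = C + N" "R3 11 = x" "R3 15 = v" "R3 12 = q"
          using R1 by (simp_all add: R3 R2)
        have CU: "C + N + x < U" using x C b by linarith
        have xU: "Suc x < U" using x b by linarith
        have line: "q \<le> max 1 (gval k (\<lambda>i. dig (Suc x) i - 1))" if "Suc x mod B \<noteq> 0"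
          using q(2) gval_line_mono[OF that, of k] unfolding h_def by linarith
        have inv: "cell_inv k (Suc x) (R3(11 := Suc x)) (H3(C + N + x := v))"
          unfolding cell_inv_def C_def[symmetric]
        proof (intro conjI allI impI, goal_cases)
          case 1 then show ?case using dims by (simp add: dims_ok_def)
        next
          case 2 then show ?case using r by simp
        next
          case 3 then show ?case using r by simp
        next
          case 4 then show ?case by simp
        next
          case (5 a) then show ?case using H3(1)[of a] R1(5)[of a] C b by simp
        next
          case (6 y) then show ?case using H3(1)[of "C + y"] R1(6)[of y] C b by simp
        next
          case (7 y) then show ?case using H3(1)[of "C + N + y"] R1(7)[of y] C b
            by (cases "y = x") (simp_all add: v_def)
        next
          case 8 then show ?case using r q by simp
        next
          case 9 then show ?case using r line by simp
        next
          case (10 c) then show ?case using H3(2)[of c] r C b by (simp add: G_eq)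
        qed
        have t: "cell_fuel (Suc x) q + 50 + T' \<le> t3" using q(3) by (simp add: cell_fuel_def F_def)
        show ?case
          apply (intro wp_Seq wp_Store wp_Assign)
          using t apply simp
          using t apply simp
          using r CU xU b(8,9) inv t by simp
      qed
    qed
  qed
qed

definition level_inv :: "nat \<Rightarrow> (nat \<Rightarrow> nat) \<Rightarrow> (nat \<Rightarrow> nat) \<Rightarrow> bool" where
  "level_inv k R H \<longleftrightarrow> dims_ok R \<and> R 9 = k \<and> R 10 = G + k * N \<and>
    (\<forall>a<W. H a = s a) \<and> (\<forall>y<N. H (G + k * N + y) = gval k (dig y))"

definition level_fuel :: nat where
  "level_fuel = cell_fuel 0 0 + 50 + 10 * N"

lemma level_end: "k \<le> n \<Longrightarrow> G + k * N + N \<le> K"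
proof -
  assume "k \<le> n"
  then have "(k + 1) * N \<le> B * N" by (intro mult_right_mono) (auto simp: B_eq)
  then show ?thesis by (simp add: K_eq algebra_simps)
qed

lemma wp_level:
  assumes I: "level_inv k R H" and k: "k < n" and T: "level_fuel + T' \<le> T"
  shows "wp level_prog (\<lambda>R' H' T''. level_inv (Suc k) R' H' \<and> T' \<le> T'') R H T"
proof -
  note b = bounds
  define J where "J = (\<lambda>R H t. \<exists>x\<le>N. cell_inv k x R H \<and> cell_fuel x (R 12) + 10 * (N - x) + 10 + T' \<le> t)"
  have lu: "G + k * N + N < U" "Suc k < U" using level_end[of k] k b by linarith+
  have f: "cell_fuel 0 q \<le> cell_fuel 0 0" for q by (simp add: cell_fuel_def)
  show ?thesis unfolding level_prog_def
  proof ((rule wp_Seq_Assign, (use T in \<open>simp add: level_fuel_def\<close>)[1])+, rule wp_While[where I = J], goal_cases)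
    case 1
    show ?case unfolding J_def
      apply (rule exI[of _ 0])
      using I T f[of "R 12"] lu b(8,9) by (simp add: cell_inv_def level_inv_def dims_ok_def level_fuel_def)
  next
    case (2 R' H' t)
    then show ?case by (auto simp: J_def)
  next
    case (3 R' H' t)
    then obtain x where x: "x \<le> N" "cell_inv k x R' H'" "cell_fuel x (R' 12) + 10 * (N - x) + 10 + T' \<le> t"
      unfolding J_def by blast
    have lt: "x < N" using 3(2) x(2) by (simp add: cell_inv_def dims_ok_def)
    have "cell_fuel x (R' 12) + (10 * (N - Suc x) + 10 + T') \<le> t - (bcost (Less (Reg 11) (Reg 5)) + 1)"
      using x(3) lt by simp
    from wp_cell[OF x(2) lt k this] show ?case
      by (rule wp_conseq) (use lt in \<open>auto simp: J_def intro!: exI[of _ "Suc x"]\<close>)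
  next
    case (4 R' H' t)
    then obtain x where x: "x \<le> N" "cell_inv k x R' H'" "cell_fuel x (R' 12) + 10 * (N - x) + 10 + T' \<le> t"
      unfolding J_def by blast
    have "x = N" using 4(2) x(1,2) by (simp add: cell_inv_def dims_ok_def)
    then show ?case using x(2,3) by (simp add: cell_inv_def level_inv_def ac_simps)
  qed
qed

lemma wp_levels:
  assumes R: "dims_ok R" and H: "\<And>a. a < W \<Longrightarrow> H a = s a" "\<And>y. y < N \<Longrightarrow> H (G + y) = Suc n"
    and L: "L = lcs_length (map S [0..<M] @ [Z])" "L < n"
    and T: "Suc L * (level_fuel + 20) + 50 \<le> T"
  shows "wp levels_prog (\<lambda>R' H' T''. R' 0 = L) R H T"
proof -
  note b = bounds
  define J where "J = (\<lambda>R H t. \<exists>k\<le>Suc L. level_inv k R H \<and> (Suc L - k) * (level_fuel + 20) + 30 \<le> t)"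
  let ?p = "Less (Const 0) (Load (Minus (Plus (Reg 10) (Reg 5)) (Const 1)))"
  have test: "bv U R H ?p \<longleftrightarrow> k \<le> L" if "level_inv k R H" "k \<le> Suc L" for k R H
  proof -
    have "\<forall>y<N. H (G + k * N + y) = gval k (dig y)" using that(1) by (simp add: level_inv_def)
    moreover have "N - 1 < N" using N_pos by simp
    ultimately have "H (G + k * N + (N - 1)) = gval k (dig (N - 1))" by blast
    then have "H (G + k * N + N - 1) = gval k (dig (N - 1))" using N_pos by simp
    moreover have "0 < gval k (dig (N - 1)) \<longleftrightarrow> k \<le> L" using gval_full_pos[of k] L(1) by (simp add: N_eq)
    moreover have "G + k * N + N < U" using level_end[of k] that(2) L(2) b by linarith
    ultimately show ?thesis using that(1) b(8,9) by (simp add: level_inv_def dims_ok_def)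
  qed
  show ?thesis unfolding levels_prog_def
  proof ((rule wp_Seq_Assign, (use T in simp)[1])+, rule wp_Seq, rule wp_While[where I = J], goal_cases)
    case 1
    show ?case unfolding J_def
      apply (rule exI[of _ 0])
      using R T H b(8,9) by (simp add: level_inv_def dims_ok_def gval_0)
  next
    case (2 R' H' t)
    then show ?case by (auto simp: J_def)
  next
    case (3 R' H' t)
    then obtain k where k: "k \<le> Suc L" "level_inv k R' H'" "(Suc L - k) * (level_fuel + 20) + 30 \<le> t"
      unfolding J_def by blast
    have kL: "k \<le> L" using test[OF k(2,1)] 3(2) by simp
    then have "Suc L - k = Suc (L - k)" by simp
    then have "level_fuel + ((L - k) * (level_fuel + 20) + 30) \<le> t - (bcost ?p + 1)"
      using k(3) by simp
    moreover have "k < n" using kL L(2) by simp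
    ultimately have "wp level_prog (\<lambda>R' H' T''. level_inv (Suc k) R' H' \<and>
      (L - k) * (level_fuel + 20) + 30 \<le> T'') R' H' (t - (bcost ?p + 1))" using wp_level[OF k(2)] by blast
    then show ?case by (rule wp_conseq) (use kL in \<open>auto simp: J_def intro!: exI[of _ "Suc k"]\<close>)
  next
    case (4 R' H' t)
    then obtain k where k: "k \<le> Suc L" "level_inv k R' H'" "(Suc L - k) * (level_fuel + 20) + 30 \<le> t"
      unfolding J_def by blast
    have "k = Suc L" using test[OF k(2,1)] 4(2) k(1) by simp
    then show ?case using k(2,3) b(8,9) by (intro wp_Assign) (auto simp: level_inv_def)
  qed
qed

end

lemma length_concat_uniform:
  "(\<And>s. s \<in> set ss \<Longrightarrow> length s = n) \<Longrightarrow> length (concat ss) = length ss * n"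
  by (induction ss) auto

lemma nth_concat_uniform:
  "(\<And>s. s \<in> set ss \<Longrightarrow> length s = n) \<Longrightarrow> i < length ss \<Longrightarrow> j < n \<Longrightarrow> concat ss ! (i * n + j) = ss ! i ! j"
proof (induction ss arbitrary: i)
  case (Cons s ss)
  then show ?case by (cases i) (auto simp: nth_append)
qed simp

context lcs_layout
begin

definition lcs_fuel :: "nat \<Rightarrow> nat" where
  "lcs_fuel L = 40 * M + 70 + (30 * W + 20 + (40 * W + 20 + (20 * N + 20 + (Suc L *
    ((100 * M + 200) * N + (40 * W + 20 * n + 100) * (N div B) + 20 * Suc n + 50 + 10 * N + 20) + 50))))"

lemma wp_lcs:
  assumes ss: "length ss = Suc M" "\<And>s. s \<in> set ss \<Longrightarrow> length s = n"
    and lt: "\<And>s x. s \<in> set ss \<Longrightarrow> x \<in> set s \<Longrightarrow> x < U"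
    and L: "L = lcs_length ss" "L < n"
    and R: "R 0 = Suc M" "R 1 = n" and H: "\<And>a. a < W \<Longrightarrow> H a = concat ss ! a"
  shows "wp lcs_prog (\<lambda>R' H' T''. R' 0 = L) R H (lcs_fuel L)"
proof -
  note b = bounds
  have lenc: "length (concat ss) = W" using length_concat_uniform[of ss n] ss by (simp add: W_eq)
  have setc: "set (concat ss) = H ` {..<W}"
    by (auto simp: set_conv_nth lenc[symmetric] H image_def simp del: set_concat)
  have HU: "H a < U" if "a < W" for a
  proof -
    have "H a \<in> set (concat ss)" using that setc by blast
    then show ?thesis using lt by auto
  qed
  define LF where "LF = Suc L *
    ((100 * M + 200) * N + (40 * W + 20 * n + 100) * (N div B) + 20 * Suc n + 50 + 10 * N + 20) + 50"
  have T1: "40 * M + 70 + (30 * W + 20 + (40 * W + 20 + (20 * N + 20 + LF))) \<le> lcs_fuel L"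
    by (simp add: lcs_fuel_def LF_def)
  show ?thesis unfolding lcs_prog_def
  proof (rule wp_Seq, rule wp_conseq[OF wp_dims[OF R T1]], goal_cases)
    case (1 R1 H1 t1)
    then have R1: "dims_ok R1" "R1 7 = K" and H1: "H1 = H"
      and t1: "30 * W + 20 + (40 * W + 20 + (20 * N + 20 + LF)) \<le> t1" by auto
    have "wp dict_prog (\<lambda>R' H' T''. R' = R1(8 := W) \<and> (\<forall>a<K. H' a = H a) \<and>
      (\<forall>a<W. \<exists>i<W. H' (K + H a div 2) = Suc i \<and> H i div 2 = H a div 2) \<and>
      40 * W + 20 + (20 * N + 20 + LF) \<le> T'') R1 H1 t1"
      unfolding H1 by (rule wp_dict) (use R1 HU t1 in auto)
    then show ?case
    proof (rule wp_Seq[OF wp_conseq], goal_cases)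
      case (1 R2 H2 t2)
      then have R2: "dims_ok R2" "R2 7 = K" and H2: "\<And>a. a < K \<Longrightarrow> H2 a = H a"
        "\<And>a. a < W \<Longrightarrow> \<exists>i<W. H2 (K + H a div 2) = Suc i \<and> H i div 2 = H a div 2"
        and t2: "40 * W + 20 + (20 * N + 20 + LF) \<le> t2" using R1 by (auto simp: dims_ok_def)
      define f where "f = (\<lambda>x. 2 * H2 (K + x div 2) + x mod 2)"
      have HW: "H2 a = H a" if "a < W" for a using that b by (intro H2) linarith
      have code: "H2 (K + H a div 2) \<le> W" if "a < W" for a using H2(2)[OF that] by auto
      have inj: "inj_on f (set (concat ss))"
      proof (rule inj_onI)
        fix x y assume xy: "x \<in> set (concat ss)" "y \<in> set (concat ss)" "f x = f y"
        then obtain a c where ac: "a < W" "x = H a" "c < W" "y = H c" unfolding setc by auto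
        have "H2 (K + x div 2) = H2 (K + y div 2)" "x mod 2 = y mod 2"
          using xy(3) unfolding f_def by presburger+
        moreover obtain i i' where "H2 (K + x div 2) = Suc i" "H i div 2 = x div 2"
          "H2 (K + y div 2) = Suc i'" "H i' div 2 = y div 2"
          using H2(2)[OF ac(1)] H2(2)[OF ac(3)] ac by auto
        ultimately have "x div 2 = y div 2" "x mod 2 = y mod 2" by auto
        then show "x = y" by (metis div_mult_mod_eq)
      qed
      have "wp rename_prog (\<lambda>R' H' T''. R' = R2(8 := W) \<and>
        H' = (\<lambda>a. if a < W then 2 * H2 (K + H2 a div 2) + H2 a mod 2 else H2 a) \<and>
        20 * N + 20 + LF \<le> T'') R2 H2 t2"
        by (rule wp_rename) (use R2 HU HW code t2 in auto)
      then show ?case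
      proof (rule wp_Seq[OF wp_conseq], goal_cases)
        case (1 R3 H3 t3)
        then have R3: "dims_ok R3" and H3: "\<And>a. a < W \<Longrightarrow> H3 a = f (H a)"
          and t3: "20 * N + 20 + LF \<le> t3" using R2 HW by (auto simp: dims_ok_def f_def)
        have "wp level0_prog (\<lambda>R' H' T''. R' = R3(8 := N) \<and>
          H' = (\<lambda>a. if G \<le> a \<and> a < G + N then B else H3 a) \<and> LF \<le> T'') R3 H3 t3"
          by (rule wp_level0) (use R3 t3 in auto)
        then show ?case
        proof (rule wp_Seq[OF wp_conseq], goal_cases)
          case (1 R4 H4 t4)
          then have R4: "dims_ok R4" and H4: "\<And>a. a < W \<Longrightarrow> H4 a = f (H a)"
            "\<And>y. y < N \<Longrightarrow> H4 (G + y) = B" and t4: "LF \<le> t4"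
            using R3 H3 b by (auto simp: dims_ok_def)
          have blk: "i * n + j < W" if "i < Suc M" "j < n" for i j
          proof -
            have "Suc i * n \<le> Suc M * n" using that by (intro mult_right_mono) auto
            moreover have "i * n + j < Suc i * n" using that by simp
            ultimately show ?thesis unfolding W_eq by linarith
          qed
          have nthf: "f (H (i * n + j)) = map f (ss ! i) ! j" if "i < Suc M" "j < n" for i j
            using that H[OF blk[OF that]] nth_concat_uniform[of ss n i j] ss by simp
          interpret run: lcs_run w U M n B W G N D K "\<lambda>i. map f (ss ! i)" "map f (ss ! M)" "\<lambda>a. f (H a)"
          proof
            show "f (H a) < 2 * W + 2" if "a < W" for a
              using code[OF that] by (simp add: f_def)
          qed (use ss M_pos nthf B_eq in auto)
          have ss': "map (\<lambda>i. map f (ss ! i)) [0..<M] @ [map f (ss ! M)] = map (map f) ss"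
            by (rule nth_equalityI) (auto simp: ss nth_append less_Suc_eq)
          have "lcs_length (map (map f) ss) = lcs_length ss"
            using ss inj by (intro lcs_length_map_inj) auto
          moreover have "Suc L * (run.level_fuel + 20) + 50 \<le> t4"
            using t4 by (simp add: LF_def run.level_fuel_def run.cell_fuel_def)
          ultimately show ?case
            by (intro run.wp_levels) (use R4 H4 B_eq ss' L in auto)
        qed
      qed
    qed
  qed
qed

lemma lcs_fuel_le:
  assumes "1 \<le> L"
  shows "lcs_fuel L \<le> 290 * W + 960 * (L * (Suc M * N))"
proof -
  note b = bounds
  let ?m = "Suc M"
  have mN: "N \<le> ?m * N" "1 \<le> ?m * N" using N_pos by simp_all
  have a1: "(100 * M + 200) * N \<le> 200 * (?m * N)" by (simp add: algebra_simps)
  have "40 * W + 20 * n + 100 \<le> 160 * (?m * B)"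
    unfolding W_eq B_eq using n_pos by (simp add: algebra_simps)
  then have "(40 * W + 20 * n + 100) * (N div B) \<le> 160 * (?m * B) * (N div B)" by (rule mult_right_mono) simp
  also have "\<dots> = 160 * (?m * (B * (N div B)))" by (simp only: mult.assoc)
  also have "\<dots> \<le> 160 * (?m * N)" by (intro mult_left_mono) simp_all
  finally have a2: "(40 * W + 20 * n + 100) * (N div B) \<le> 160 * (?m * N)" .
  have a3: "20 * Suc n \<le> 20 * (?m * N)" using b(11) mN(1) by (simp add: B_eq)
  have "(100 * M + 200) * N + (40 * W + 20 * n + 100) * (N div B) + 20 * Suc n + 50 + 10 * N + 20 \<le> 460 * (?m * N)"
    using a1 a2 a3 mN by linarith
  then have "Suc L * ((100 * M + 200) * N + (40 * W + 20 * n + 100) * (N div B) + 20 * Suc n + 50 + 10 * N + 20)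
      \<le> (2 * L) * (460 * (?m * N))"
    using assms by (intro mult_mono) auto
  moreover have "?m * N \<le> L * (?m * N)" using assms by simp
  ultimately show ?thesis unfolding lcs_fuel_def using b mN by linarith
qed

end

lemma table_fits_word:
  fixes m n w :: nat
  assumes m: "2 \<le> m" and n: "2 \<le> n" and w: "real w \<ge> real 8 * real m * log 2 (real n)"
  shows "2 * (3 * (m * n) + 2 + Suc n ^ m) \<le> 2 ^ w"
proof -
  have "real (n ^ (8 * m)) = real n powr real (8 * m)"
    using n powr_realpow[of "real n" "8 * m"] by simp
  also have "\<dots> = (2 powr (log 2 (real n))) powr real (8 * m)" using n by simp
  also have "\<dots> = 2 powr (real 8 * real m * log 2 (real n))" by (simp add: powr_powr mult.commute)
  also have "\<dots> \<le> 2 powr (real w)" using w by (intro powr_mono) auto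
  also have "\<dots> = real (2 ^ w)" by (simp add: powr_realpow)
  finally have U: "n ^ (8 * m) \<le> 2 ^ w" by (simp only: of_nat_le_iff)
  define q where "q = n ^ (2 * m)"
  have "2 * n \<le> n * n" using n by (rule mult_right_mono) simp
  then have "Suc n \<le> n ^ 2" unfolding power2_eq_square using n by linarith
  then have "Suc n ^ m \<le> (n ^ 2) ^ m" by (rule power_mono) simp
  then have q1: "Suc n ^ m \<le> q" by (simp add: q_def power_mult)
  have "m \<le> 2 ^ m" by (simp add: less_imp_le)
  also have "(2 :: nat) ^ m \<le> n ^ m" using n by (intro power_mono) auto
  finally have "m \<le> n ^ m" .
  moreover have "n ^ 1 \<le> n ^ m" using m n by (intro power_increasing) auto
  ultimately have "m * n \<le> n ^ m * n ^ m" by (intro mult_mono) auto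
  then have q2: "m * n \<le> q" by (simp add: q_def power_add[symmetric] mult_2)
  have "n ^ 1 \<le> q" unfolding q_def using m n by (intro power_increasing) auto
  then have q3: "2 \<le> q" using n by simp
  have "2 ^ 6 \<le> n ^ 6" using n by (intro power_mono) auto
  also have "n ^ 6 \<le> n ^ (6 * m)" using m n by (intro power_increasing) auto
  finally have "12 \<le> n ^ (6 * m)" by simp
  then have "12 * q \<le> n ^ (6 * m) * q" by (rule mult_right_mono) simp
  also have "\<dots> = n ^ (8 * m)" by (simp add: q_def power_add[symmetric])
  also note U
  finally have "12 * q \<le> 2 ^ w" .
  moreover have "2 * (3 * (m * n) + 2 + Suc n ^ m) \<le> 12 * q"
    using q1 q2 q3 unfolding distrib_left by linarith
  ultimately show ?thesis by (rule order_trans[rotated])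
qed

theorem theorem8:
  "\<exists>(P :: com) (c :: real) (k :: nat) (d :: nat). c > 0 \<and>
    (\<forall>(m :: nat) (n :: nat) (ss :: nat list list) (lam :: real) (w :: nat).
      m \<ge> 1 \<longrightarrow> n \<ge> 1 \<longrightarrow>
      length ss = m \<longrightarrow> (\<forall>s\<in>set ss. length s = n) \<longrightarrow>
      0 < lam \<longrightarrow> lam < 1 \<longrightarrow> real (lcs_length ss) = lam * real n \<longrightarrow>
      real w \<ge> real d * real m * log 2 (real n) \<longrightarrow>
      (\<forall>s\<in>set ss. \<forall>x\<in>set s. x < 2 ^ w) \<longrightarrow>
      (\<exists>t \<tau>. exec w P (input_state m n ss) t \<tau> \<and> result_of \<tau> = lcs_length ss \<and>
        real t \<le> suppressed_factor c k m n * (lam * real n ^ m + real n * real m)))"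
proof (rule exI[of _ lcs_prog], rule exI[of _ 4000], rule exI[of _ 0], rule exI[of _ 8],
    intro conjI allI impI)
  fix m n :: nat and ss :: "nat list list" and lam :: real and w :: nat
  assume m: "1 \<le> m" and n: "1 \<le> n" and ss: "length ss = m" "\<forall>s\<in>set ss. length s = n"
    and lam: "0 < lam" "lam < 1" "real (lcs_length ss) = lam * real n"
    and w: "real w \<ge> real 8 * real m * log 2 (real n)" and letters: "\<forall>s\<in>set ss. \<forall>x\<in>set s. x < 2 ^ w"
  define L where "L = lcs_length ss"
  have "0 < real L" "real L < real n" using lam n by (simp_all add: L_def)
  then have L: "1 \<le> L" "L < n" by simp_all
  then have n2: "2 \<le> n" by simp
  have m2: "2 \<le> m"
  proof (rule ccontr)
    assume "\<not> 2 \<le> m"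
    then obtain s where s: "ss = [s]" using m ss(1) by (cases ss; cases "tl ss") auto
    then have "n \<le> L" unfolding L_def using ss(2) by (subst le_lcs_length_iff) (auto intro!: exI[of _ s])
    then show False using L by simp
  qed
  define M where "M = m - 1"
  have mM: "m = Suc M" using m by (simp add: M_def)
  define W where "W = m * n"
  define N where "N = Suc n ^ M"
  interpret lcs_layout w "2 ^ w" M n "Suc n" W "3 * W + 2" N "\<Sum>i<M. Suc n ^ i" "3 * W + 2 + N * Suc n"
  proof
    show "2 * (3 * W + 2 + N * Suc n) \<le> 2 ^ w"
      using table_fits_word[OF m2 n2 w] by (simp add: W_def N_def mM mult.commute del: mult_Suc mult_Suc_right)
  qed (use m2 n2 in \<open>simp_all add: W_def N_def mM\<close>)
  define R where "R = (\<lambda>r :: nat. if r = 0 then m else if r = 1 then n else 0)"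
  define H where "H = (\<lambda>a. if a < length (concat ss) then concat ss ! a else 0)"
  have "length (concat ss) = W" using length_concat_uniform[of ss n] ss by (simp add: W_def)
  then have "wp lcs_prog (\<lambda>R' H' T''. R' 0 = L) R H (lcs_fuel L)"
    using ss letters L by (intro wp_lcs[of ss]) (auto simp: R_def H_def mM L_def)
  then obtain t R' H' where t: "exec w lcs_prog (input_state m n ss) t \<lparr>regs = R', mem = H'\<rparr>"
    "t \<le> lcs_fuel L" "R' 0 = L"
    unfolding wp_def input_state_def R_def H_def by blast
  have "real t \<le> suppressed_factor 4000 0 m n * (lam * real n ^ m + real n * real m)"
  proof -
    have "real N \<le> 2 ^ M * real n ^ M"
      unfolding N_def power_mult_distrib[symmetric] of_nat_power using n by (intro power_mono) auto
    moreover have "real m \<le> 2 ^ m" using of_nat_le_iff[of m "2 ^ m", where 'a = real] by (simp add: less_imp_le)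
    ultimately have "real m * real N \<le> 2 ^ m * (2 ^ M * real n ^ M)" by (intro mult_mono) auto
    also have "\<dots> \<le> 2 ^ m * (2 ^ m * real n ^ M)" by (intro mult_left_mono mult_right_mono) (auto simp: mM)
    also have "\<dots> = 4 ^ m * real n ^ M" by (simp add: power_mult_distrib[symmetric])
    finally have mN: "real m * real N \<le> 4 ^ m * real n ^ M" .
    have "real t \<le> real (290 * W + 960 * (L * (Suc M * N)))"
      using t(2) lcs_fuel_le[OF L(1)] by linarith
    also have "\<dots> = 290 * (real n * real m) + 960 * (real L * (real m * real N))"
      unfolding mM[symmetric] by (simp add: W_def)
    also have "\<dots> \<le> 290 * (real n * real m) + 960 * (real L * (4 ^ m * real n ^ M))"
      using mN by (intro add_left_mono mult_left_mono) auto
    also have "\<dots> = 290 * (real n * real m) + 960 * 4 ^ m * (lam * real n ^ m)"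
      using lam(3) by (simp add: L_def mM)
    also have "\<dots> \<le> 4000 ^ m * (real n * real m) + 4000 ^ m * (lam * real n ^ m)"
    proof (intro add_mono mult_right_mono)
      have "(4000 :: real) ^ 1 \<le> 4000 ^ m" using m by (intro power_increasing) auto
      then show "290 \<le> (4000 :: real) ^ m" by simp
      have "(1000 :: real) ^ 1 \<le> 1000 ^ m" using m by (intro power_increasing) auto
      then have "960 * 4 ^ m \<le> (1000 :: real) ^ m * 4 ^ m" by (intro mult_right_mono) auto
      then show "960 * 4 ^ m \<le> (4000 :: real) ^ m" by (simp add: power_mult_distrib[symmetric])
    qed (use lam in auto)
    also have "\<dots> = 4000 ^ m * (lam * real n ^ m + real n * real m)" by (simp add: algebra_simps)
    also have "\<dots> \<le> suppressed_factor 4000 0 m n * (lam * real n ^ m + real n * real m)"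
    proof (rule mult_right_mono)
      have "log 2 (real n) \<ge> 1" using n2 by simp
      then have "1 \<le> (log 2 (real n)) ^ m" by (rule one_le_power)
      then show "4000 ^ m \<le> suppressed_factor 4000 0 m n" by (simp add: suppressed_factor_def)
    qed (use lam in auto)
    finally show ?thesis .
  qed
  then show "\<exists>t \<tau>. exec w lcs_prog (input_state m n ss) t \<tau> \<and> result_of \<tau> = lcs_length ss \<and>
    real t \<le> suppressed_factor 4000 0 m n * (lam * real n ^ m + real n * real m)"
    using t(1,3) by (intro exI[of _ t] exI[of _ "\<lparr>regs = R', mem = H'\<rparr>"]) (simp add: result_of_def L_def)
qed simp

end
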